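(* There is an absolute constant $\alpha>0$ such that the following holds. For every finite point set $X\subseteq\mathbb{R}^d$ and all integers $k\ge 2$, $\ell\ge 1$, the set $C$ of $k$ centers returned by greedy $k$-means++ run on $X$ with parameters $k$ and $\ell$ satisfies \[\mathbb{E}[\phi(X,C)]\le \alpha\,\ell^3\log^3 k\cdot \mathrm{OPT}_k(X),\] i.e. greedy $k$-means++ is an $O(\ell^3\log^3 k)$-approximation algorithm for $k$-means, in expectation.
   Context: For $x\in\mathbb{R}^d$ and a finite set $C\subseteq\mathbb{R}^d$, $\phi(x,C)=\min_{c\in C}\|x-c\|_2^2$, and for $Y\subseteq X$, $\phi(Y,C)=\sum_{x\in Y}\phi(x,C)$. The $k$-means problem asks for $C\subseteq\mathbb{R}^d$ with $|C|=k$ minimizing $\phi(X,C)$; $\mathrm{OPT}_k(X)$ denotes this minimum. Greedy $k$-means++ with parameters $k,\ell$: sample $c_1^1,\dots,c_1^\ell\in X$ independently and uniformly at random, let $c_1$ be the one minimizing $\phi(X,\{c\})$ and set $C_1=\{c_1\}$. For $i=1,\dots,k-1$: sample $c_{i+1}^1,\dots,c_{i+1}^\ell\in X$ independently, where each is equal to $x\in X$ with probability $\phi(x,C_i)/\phi(X,C_i)$; let $c_{i+1}$ be the candidate $c\in\{c_{i+1}^1,\dots,c_{i+1}^\ell\}$ minimizing $\phi(X,C_i\cup\{c\})$, and set $C_{i+1}=C_i\cup\{c_{i+1}\}$. Output $C=C_k$. Logarithms are natural. *)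

theory Defs
  imports "HOL-Probability.Probability"
begin

text \<open>Points of R^d are represented as functions nat \<Rightarrow> real vanishing at all
  coordinates i \<ge> d, so that the dimension d can be quantified inside the statement.\<close>

definition Rd :: "nat \<Rightarrow> (nat \<Rightarrow> real) set" where
  "Rd d = {x. \<forall>i\<ge>d. x i = 0}"

definition sqdist :: "nat \<Rightarrow> (nat \<Rightarrow> real) \<Rightarrow> (nat \<Rightarrow> real) \<Rightarrow> real" where
  "sqdist d x y = (\<Sum>i<d. (x i - y i)^2)"

definition phi :: "nat \<Rightarrow> (nat \<Rightarrow> real) \<Rightarrow> (nat \<Rightarrow> real) set \<Rightarrow> real" where
  "phi d x C = Min ((\<lambda>c. sqdist d x c) ` C)"

definition phiS :: "nat \<Rightarrow> (nat \<Rightarrow> real) set \<Rightarrow> (nat \<Rightarrow> real) set \<Rightarrow> real" where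
  "phiS d Y C = (\<Sum>x\<in>Y. phi d x C)"

definition OPT :: "nat \<Rightarrow> nat \<Rightarrow> (nat \<Rightarrow> real) set \<Rightarrow> real" where
  "OPT d k X = Inf {phiS d X C | C. C \<subseteq> Rd d \<and> finite C \<and> card C = k}"

primrec iid_pmf :: "nat \<Rightarrow> 'a pmf \<Rightarrow> 'a list pmf" where
  "iid_pmf 0 p = return_pmf []"
| "iid_pmf (Suc n) p = do { x \<leftarrow> p; xs \<leftarrow> iid_pmf n p; return_pmf (x # xs) }"

definition first_argmin :: "('a \<Rightarrow> real) \<Rightarrow> 'a list \<Rightarrow> 'a" where
  "first_argmin f xs = hd (filter (\<lambda>x. f x = Min (f ` set xs)) xs)"

text \<open>D^2 sampling: x in X with probability phi(x,C)/phi(X,C). If phi(X,C)=0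
  (all points already covered) we sample uniformly; this case does not affect the cost.\<close>
definition D2_pmf :: "nat \<Rightarrow> (nat \<Rightarrow> real) set \<Rightarrow> (nat \<Rightarrow> real) set \<Rightarrow> (nat \<Rightarrow> real) pmf" where
  "D2_pmf d X C = (if phiS d X C = 0 then pmf_of_set X
     else embed_pmf (\<lambda>x. if x \<in> X then phi d x C / phiS d X C else 0))"

definition greedy_first :: "nat \<Rightarrow> (nat \<Rightarrow> real) set \<Rightarrow> nat \<Rightarrow> (nat \<Rightarrow> real) set pmf" where
  "greedy_first d X l = map_pmf (\<lambda>cs. {first_argmin (\<lambda>c. phiS d X {c}) cs}) (iid_pmf l (pmf_of_set X))"

definition greedy_step :: "nat \<Rightarrow> (nat \<Rightarrow> real) set \<Rightarrow> nat \<Rightarrow> (nat \<Rightarrow> real) set \<Rightarrow> (nat \<Rightarrow> real) set pmf" where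
  "greedy_step d X l C = map_pmf (\<lambda>cs. insert (first_argmin (\<lambda>c. phiS d X (insert c C)) cs) C)
      (iid_pmf l (D2_pmf d X C))"

primrec greedy_kmeanspp :: "nat \<Rightarrow> (nat \<Rightarrow> real) set \<Rightarrow> nat \<Rightarrow> nat \<Rightarrow> (nat \<Rightarrow> real) set pmf" where
  "greedy_kmeanspp d X l 0 = greedy_first d X l"
| "greedy_kmeanspp d X l (Suc i) = bind_pmf (greedy_kmeanspp d X l i) (greedy_step d X l)"

text \<open>greedy_kmeanspp d X l i is the distribution of C_(i+1); so C_k is index k - 1.\<close>

end

theory Submission
  imports Defs
begin

text \<open>
  Fix any \<open>k\<close> comparison centres and split \<open>X\<close> into the clusters they induce. A cluster \<open>K\<close> with
  comparison centre \<open>\<mu>\<close> and comparison cost \<open>Opt\<close> is called solved once a point of \<open>K\<close> has been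
  chosen or its cost is \<open>O(log k) Opt\<close>.

  A chosen point of \<open>K\<close> follows the \<open>D\<^sup>2\<close> law up to a factor \<open>l\<close>, so the expected cost of \<open>K\<close> when it
  becomes solved is \<open>O(l Opt)\<close> times the expected sum, over the steps before that, of the share
  of \<open>K\<close> in the total cost. This sum is \<open>O(l log\<^sup>2 k)\<close>: if sampling a central point of \<open>K\<close> does not
  lead to its choice with constant probability, then, the candidates being independent, the total
  cost drops by a multiple of the cost of \<open>K\<close> with constant probability anyway. This can go on
  only for \<open>O(log k)\<close> units of the sum, unless a choice closer to \<open>\<mu>\<close> lowers the scale of \<open>K\<close>; the
  number of points within the current scale of \<open>\<mu>\<close> controls such changes of scale.

  Hence solved clusters cost \<open>O(l\<^sup>2 log\<^sup>2 k)\<close> times the comparison cost in expectation.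
  A step is wasted only if it chooses a point of a solved cluster, and since the greedy choice decreases the total cost at least as
  much as one \<open>D\<^sup>2\<close> sample does, a potential argument as for plain \<open>k\<close>-means++ shows that unsolved
  clusters contribute at most another factor \<open>O(l log k)\<close>.
\<close>

section \<open>The best of several independent samples\<close>

lemma first_argmin_in_set:
  assumes "xs \<noteq> []" shows "first_argmin f xs \<in> set xs" "f (first_argmin f xs) = Min (f ` set xs)"
proof -
  have "Min (f ` set xs) \<in> f ` set xs" using assms by (intro Min_in) auto
  then have ne: "filter (\<lambda>x. f x = Min (f ` set xs)) xs \<noteq> []"
    by (auto simp: filter_empty_conv)
  from hd_in_set[OF ne] show "first_argmin f xs \<in> set xs" "f (first_argmin f xs) = Min (f ` set xs)"
    unfolding first_argmin_def by auto
qed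

lemma first_argmin_le:
  assumes "y \<in> set xs" shows "f (first_argmin f xs) \<le> f y"
proof -
  have "xs \<noteq> []" using assms by auto
  from first_argmin_in_set(2)[OF this, of f] show ?thesis using assms by simp
qed

lemma iid_pmf_Suc_map:
  "iid_pmf (Suc n) p = map_pmf (\<lambda>(x, xs). x # xs) (pair_pmf p (iid_pmf n p))"
  by (simp add: pair_pmf_def map_bind_pmf map_pmf_def[symmetric] pmf.map_comp o_def)

lemma set_iid_pmf: "set_pmf (iid_pmf n p) = {xs. length xs = n \<and> set xs \<subseteq> set_pmf p}"
proof (induction n)
  case (Suc n)
  have "set_pmf (iid_pmf (Suc n) p) = (\<lambda>(x, xs). x # xs) ` (set_pmf p \<times> set_pmf (iid_pmf n p))"
    by (simp add: iid_pmf_Suc_map del: iid_pmf.simps)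
  then show ?case unfolding Suc by (auto simp: length_Suc_conv image_iff)
qed auto

lemma finite_set_iid_pmf: "finite (set_pmf p) \<Longrightarrow> finite (set_pmf (iid_pmf n p))"
  using finite_lists_length_eq[of "set_pmf p" n] by (simp add: set_iid_pmf conj_commute)

lemma prob_pair_pmf_Times:
  "measure_pmf.prob (pair_pmf p q) (A \<times> B) = measure_pmf.prob p A * measure_pmf.prob q B"
proof -
  have "measure_pmf.prob (pair_pmf p q) (A \<times> B)
      = measure_pmf.prob (pair_pmf p q) ((A \<inter> set_pmf p) \<times> (B \<inter> set_pmf q))"
    by (intro measure_prob_cong_0) (auto simp: pmf_pair set_pmf_iff)
  also have "\<dots> = measure_pmf.prob p (A \<inter> set_pmf p) * measure_pmf.prob q (B \<inter> set_pmf q)"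
    by (intro measure_pmf_prob_product) (auto intro: countable_Int2)
  finally show ?thesis by (simp add: measure_Int_set_pmf)
qed

lemma prob_iid_pmf_Suc:
  "measure_pmf.prob (iid_pmf (Suc n) p) {xs. hd xs \<in> A \<and> tl xs \<in> B}
     = measure_pmf.prob p A * measure_pmf.prob (iid_pmf n p) B"
proof -
  have "(\<lambda>(x, xs). x # xs) -` {xs. hd xs \<in> A \<and> tl xs \<in> B} = A \<times> B" by auto
  then show ?thesis
    by (simp add: iid_pmf_Suc_map prob_pair_pmf_Times del: iid_pmf.simps)
qed

lemma prob_iid_pmf_all:
  "measure_pmf.prob (iid_pmf n p) {xs. set xs \<subseteq> A} = measure_pmf.prob p A ^ n"
proof (induction n)
  case (Suc n)
  have "measure_pmf.prob (iid_pmf (Suc n) p) {xs. set xs \<subseteq> A}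
      = measure_pmf.prob (iid_pmf (Suc n) p) {xs. hd xs \<in> A \<and> tl xs \<in> {xs. set xs \<subseteq> A}}"
    by (rule measure_pmf.finite_measure_eq_AE) 
       (auto simp: AE_measure_pmf_iff set_iid_pmf length_Suc_conv simp del: iid_pmf.simps)
  then show ?case using Suc prob_iid_pmf_Suc[of n p A "{xs. set xs \<subseteq> A}"] by simp
qed simp

definition greedy_choice :: "('a \<Rightarrow> real) \<Rightarrow> nat \<Rightarrow> 'a pmf \<Rightarrow> 'a pmf" where
  "greedy_choice f l p = map_pmf (first_argmin f) (iid_pmf l p)"

lemma set_greedy_choice:
  assumes "l \<ge> 1" shows "set_pmf (greedy_choice f l p) \<subseteq> set_pmf p"
proof
  fix x assume "x \<in> set_pmf (greedy_choice f l p)"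
  then obtain xs where xs: "length xs = l" "set xs \<subseteq> set_pmf p" "x = first_argmin f xs"
    by (auto simp: greedy_choice_def set_iid_pmf)
  moreover have "xs \<noteq> []" using xs(1) assms by auto
  ultimately show "x \<in> set_pmf p" using first_argmin_in_set(1)[of xs f] by auto
qed

text \<open>The point \<open>x\<close> is chosen only if some candidate equals \<open>x\<close>; by
  Bernoulli's inequality this is at most \<open>l\<close> times as likely as a single sample giving
  \<open>x\<close>.\<close>

lemma pmf_greedy_choice_le:
  assumes "l \<ge> 1"
  shows "pmf (greedy_choice f l p) x \<le> real l * pmf p x"
proof -
  have "pmf (greedy_choice f l p) x
      = measure_pmf.prob (iid_pmf l p) (first_argmin f -` {x})"
    by (simp add: greedy_choice_def pmf_map)
  also have "\<dots> \<le> measure_pmf.prob (iid_pmf l p) (- {xs. set xs \<subseteq> - {x}})"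
  proof (rule measure_pmf.finite_measure_mono_AE)
    show "AE xs in measure_pmf (iid_pmf l p). xs \<in> first_argmin f -` {x} \<longrightarrow> xs \<in> - {xs. set xs \<subseteq> - {x}}"
      unfolding AE_measure_pmf_iff
    proof (intro ballI impI)
      fix xs assume "xs \<in> set_pmf (iid_pmf l p)" and x: "xs \<in> first_argmin f -` {x}"
      then have "xs \<noteq> []" using assms by (auto simp: set_iid_pmf)
      with x show "xs \<in> - {xs. set xs \<subseteq> - {x}}"
        using first_argmin_in_set(1)[of xs f] by auto
    qed
  qed simp
  also have "\<dots> = 1 - measure_pmf.prob p (- {x}) ^ l"
    using measure_pmf.prob_compl[of "{xs. set xs \<subseteq> - {x}}" "iid_pmf l p"]
    by (simp add: prob_iid_pmf_all Compl_eq_Diff_UNIV)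
  also have "measure_pmf.prob p (- {x}) = 1 - pmf p x"
    using measure_pmf.prob_compl[of "{x}" p] by (simp add: Compl_eq_Diff_UNIV measure_pmf_single)
  also have "1 - (1 - pmf p x) ^ l \<le> real l * pmf p x"
    using Bernoulli_inequality[of "- pmf p x" l] by (simp add: pmf_le_1)
  finally show ?thesis .
qed

text \<open>The chosen candidate is at least as good as the first one, which alone has law
  \<open>p\<close>.\<close>

lemma expectation_greedy_choice_le:
  assumes "l \<ge> 1" "finite (set_pmf p)"
  shows "measure_pmf.expectation (greedy_choice f l p) f \<le> measure_pmf.expectation p f"
proof -
  obtain n where l: "l = Suc n" using assms(1) by (cases l) auto
  have fin: "finite (set_pmf (iid_pmf l p))" using assms finite_set_iid_pmf by blast
  have "measure_pmf.expectation (greedy_choice f l p) f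
      = measure_pmf.expectation (iid_pmf l p) (\<lambda>xs. f (first_argmin f xs))"
    by (simp add: greedy_choice_def)
  also have "\<dots> \<le> measure_pmf.expectation (iid_pmf l p) (\<lambda>xs. f (hd xs))"
  proof (rule integral_mono_AE)
    show "AE xs in measure_pmf (iid_pmf l p). f (first_argmin f xs) \<le> f (hd xs)"
      unfolding AE_measure_pmf_iff using assms(1)
      by (auto simp: set_iid_pmf intro!: first_argmin_le hd_in_set)
  qed (auto intro!: integrable_measure_pmf_finite fin)
  also have "\<dots> = measure_pmf.expectation (map_pmf fst (pair_pmf p (iid_pmf n p))) f"
    by (simp add: l iid_pmf_Suc_map case_prod_beta del: iid_pmf.simps map_fst_pair_pmf)
  finally show ?thesis by (simp add: map_fst_pair_pmf)
qed

text \<open>The candidates are independent. Hence a candidate in \<open>A\<close> is displaced by another one only if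
  candidates of value at most \<open>\<theta>\<close> have probability of order \<open>1/l\<close>; but then the chosen
  value is at most \<open>\<theta>\<close> with constant probability, whether or not \<open>A\<close> was sampled.\<close>

lemma greedy_choice_dichotomy:
  assumes l: "l \<ge> 1" and A: "\<And>x. x \<in> A \<Longrightarrow> f x \<le> \<theta>"
  shows "measure_pmf.prob (greedy_choice f l p) {x. f x \<le> \<theta>} \<ge> 1/3 \<or>
         measure_pmf.prob (greedy_choice f l p) A \<ge> measure_pmf.prob p A / 2"
proof -
  obtain n where n: "l = Suc n" using l by (cases l) auto
  define q where "q = measure_pmf.prob p {x. f x \<le> \<theta>}"
  have q01: "0 \<le> q" "q \<le> 1" by (auto simp: q_def)
  have cq: "measure_pmf.prob p {x. f x > \<theta>} = 1 - q"
    using measure_pmf.prob_compl[of "{x. f x \<le> \<theta>}" p]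
    by (simp add: q_def Compl_eq_Diff_UNIV[symmetric] Collect_neg_eq[symmetric] not_le)
  show ?thesis
  \<comment> \<open>\<open>l * q\<close> is the expected number of candidates of value at most
    \<theta>. If it is large, one of them appears with probability at least 1/3; otherwise the
    candidates after the first all exceed \<theta> with probability at least 1/2, and then a first
    candidate in \<open>A\<close> wins.\<close>
  proof (cases "real l * q \<ge> 1/2")
    case True
    \<comment> \<open>This yields
      \<open>(1 - q) ^ l \<le> 1 / (1 + l * q) \<le> 2/3\<close>.\<close>
    have "(1 - q) ^ l * (1 + real l * q) \<le> (1 - q) ^ l * (1 + q) ^ l"
      using Bernoulli_inequality[of q l] q01 by (intro mult_left_mono) auto
    also have "\<dots> = (1 - q\<^sup>2) ^ l"
      by (simp add: power_mult_distrib[symmetric] algebra_simps power2_eq_square)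
    also have "\<dots> \<le> 1" using q01 by (intro power_le_one) (auto simp: power_le_one)
    finally have "(1 - q) ^ l * (1 + real l * q) \<le> 1" .
    moreover have "(1 - q) ^ l * (3/2) \<le> (1 - q) ^ l * (1 + real l * q)"
      using True q01 by (intro mult_left_mono) auto
    ultimately have "1/3 \<le> 1 - (1 - q) ^ l" by simp
    also have "\<dots> = measure_pmf.prob (iid_pmf l p) (- {xs. set xs \<subseteq> {x. f x > \<theta>}})"
      using measure_pmf.prob_compl[of "{xs. set xs \<subseteq> {x. f x > \<theta>}}" "iid_pmf l p"]
      by (simp add: prob_iid_pmf_all cq Compl_eq_Diff_UNIV)
    also have "\<dots> \<le> measure_pmf.prob (iid_pmf l p) (first_argmin f -` {x. f x \<le> \<theta>})"
    proof (intro measure_pmf.finite_measure_mono subsetI)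
      fix xs assume "xs \<in> - {xs. set xs \<subseteq> {x. f x > \<theta>}}"
      then obtain y where "y \<in> set xs" "f y \<le> \<theta>" by (force simp: not_less)
      with first_argmin_le[of y xs f] show "xs \<in> first_argmin f -` {x. f x \<le> \<theta>}" by simp
    qed simp
    finally show ?thesis by (simp add: greedy_choice_def)
  next
    case False
    have "1/2 \<le> 1 - real n * q" using False q01 n by (simp add: algebra_simps)
    also have "\<dots> \<le> (1 - q) ^ n" using Bernoulli_inequality[of "- q" n] q01 by simp
    finally have "measure_pmf.prob p A / 2 \<le> measure_pmf.prob p A * (1 - q) ^ n"
      using mult_left_mono[of "1/2" "(1 - q) ^ n" "measure_pmf.prob p A"] by simp
    also have "\<dots> = measure_pmf.prob (iid_pmf l p)
        {xs. hd xs \<in> A \<and> tl xs \<in> {xs. set xs \<subseteq> {x. f x > \<theta>}}}"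
      unfolding n prob_iid_pmf_Suc prob_iid_pmf_all cq ..
    also have "\<dots> \<le> measure_pmf.prob (iid_pmf l p) (first_argmin f -` A)"
    proof (rule measure_pmf.finite_measure_mono_AE)
      show "AE xs in measure_pmf (iid_pmf l p).
         xs \<in> {xs. hd xs \<in> A \<and> tl xs \<in> {xs. set xs \<subseteq> {x. f x > \<theta>}}} \<longrightarrow> xs \<in> first_argmin f -` A"
        unfolding AE_measure_pmf_iff
      proof (intro ballI impI)
        fix xs assume "xs \<in> set_pmf (iid_pmf l p)"
          and xs: "xs \<in> {xs. hd xs \<in> A \<and> tl xs \<in> {xs. set xs \<subseteq> {x. f x > \<theta>}}}"
        then obtain y ys where "xs = y # ys" using n by (auto simp: set_iid_pmf length_Suc_conv simp del: iid_pmf.simps)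
        with xs first_argmin_in_set(1)[of xs f] first_argmin_le[of y xs f] A[of y]
        show "xs \<in> first_argmin f -` A" by force
      qed
    qed simp
    finally show ?thesis by (simp add: greedy_choice_def)
  qed
qed

section \<open>Squared distances and costs\<close>

lemma sqdist_nonneg [simp]: "0 \<le> sqdist d x y"
  by (simp add: sqdist_def sum_nonneg)

lemma sqdist_commute: "sqdist d x y = sqdist d y x"
  by (simp add: sqdist_def power2_commute)

lemma sqdist_triangle: "sqdist d x z \<le> 2 * sqdist d x y + 2 * sqdist d y z"
proof -
  have "(x i - z i)\<^sup>2 \<le> 2 * (x i - y i)\<^sup>2 + 2 * (y i - z i)\<^sup>2" for i
    using zero_le_power2[of "(x i - y i) - (y i - z i)"] by (simp add: power2_eq_square algebra_simps)
  then show ?thesis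
    unfolding sqdist_def sum_distrib_left sum.distrib[symmetric] by (intro sum_mono)
qed

lemma phi_le: "finite C \<Longrightarrow> c \<in> C \<Longrightarrow> phi d x C \<le> sqdist d x c"
  by (simp add: phi_def)

lemma phi_attained:
  assumes "finite C" "C \<noteq> {}" obtains c where "c \<in> C" "phi d x C = sqdist d x c"
proof -
  have "phi d x C \<in> sqdist d x ` C" unfolding phi_def using assms by (intro Min_in) auto
  then show ?thesis using that by blast
qed

lemma phi_nonneg: "finite C \<Longrightarrow> C \<noteq> {} \<Longrightarrow> 0 \<le> phi d x C"
  by (metis phi_attained sqdist_nonneg)

lemma phi_insert:
  "finite C \<Longrightarrow> C \<noteq> {} \<Longrightarrow> phi d x (insert c C) = min (sqdist d x c) (phi d x C)"
  by (simp add: phi_def)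

lemma phi_triangle:
  assumes "finite C" "C \<noteq> {}" shows "phi d x C \<le> 2 * sqdist d x y + 2 * phi d y C"
proof -
  obtain c where c: "c \<in> C" "phi d y C = sqdist d y c" using phi_attained[OF assms] .
  have "phi d x C \<le> sqdist d x c" using c assms by (simp add: phi_le)
  with sqdist_triangle[of d x c y] c show ?thesis by simp
qed

lemma phiS_nonneg: "finite C \<Longrightarrow> C \<noteq> {} \<Longrightarrow> 0 \<le> phiS d Y C"
  by (simp add: phiS_def sum_nonneg phi_nonneg)

lemma phiS_insert_le: "finite C \<Longrightarrow> C \<noteq> {} \<Longrightarrow> phiS d Y (insert c C) \<le> phiS d Y C"
  unfolding phiS_def by (intro sum_mono) (simp add: phi_insert)

lemma phiS_mono: "finite Z \<Longrightarrow> Y \<subseteq> Z \<Longrightarrow> finite C \<Longrightarrow> C \<noteq> {} \<Longrightarrow> phiS d Y C \<le> phiS d Z C"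
  unfolding phiS_def by (intro sum_mono2) (auto simp: phi_nonneg)

text \<open>Each pair is compared through \<open>\<mu>\<close>, which may differ from the centroid
  of \<open>K\<close>; hence the factor 4 instead of 2.\<close>

lemma sum_sqdist_pairs_le:
  assumes "finite K"
  shows "(\<Sum>x\<in>K. \<Sum>y\<in>K. sqdist d y x) \<le> 4 * real (card K) * (\<Sum>x\<in>K. sqdist d x \<mu>)"
proof -
  have "(\<Sum>x\<in>K. \<Sum>y\<in>K. sqdist d y x) \<le> (\<Sum>x\<in>K. \<Sum>y\<in>K. 2 * sqdist d y \<mu> + 2 * sqdist d x \<mu>)"
    by (intro sum_mono) (metis sqdist_commute sqdist_triangle)
  also have "\<dots> = 4 * real (card K) * (\<Sum>x\<in>K. sqdist d x \<mu>)"
    by (simp add: sum.distrib sum_distrib_left[symmetric] algebra_simps)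
  finally show ?thesis .
qed

text \<open>Divided by \<open>phiS d K C\<close>, the left side is the expected new cost of
  \<open>K\<close> after a D^2 sample from \<open>K\<close>. In
  \<open>phi d x C \<le> 2 * sqdist d x \<mu> + 2 * phi d \<mu> C\<close> the first part is
  multiplied by the old cost of \<open>K\<close>; the second does not depend on \<open>x\<close>, so
  there the sum over pairs applies. The constant is \<open>26 = 2 + 8 * 3\<close>.\<close>

lemma D2_weighted_cost_le:
  fixes K :: "(nat \<Rightarrow> real) set"
  assumes K: "finite K" and C: "finite C" "C \<noteq> {}"
    and O: "Opt = (\<Sum>x\<in>K. sqdist d x \<mu>)"
    and small: "2 * Opt \<le> phiS d K C"
  shows "(\<Sum>x\<in>K. phi d x C * phiS d K (insert x C)) \<le> 26 * phiS d K C * Opt"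
proof -
  let ?m = "phi d \<mu> C"
  have O0: "0 \<le> Opt" by (simp add: O sum_nonneg)
  have m0: "0 \<le> ?m" using C by (rule phi_nonneg)
  have m: "real (card K) * ?m \<le> 3 * phiS d K C"
  proof -
    have "real (card K) * ?m = (\<Sum>x\<in>K. ?m)" by simp
    also have "\<dots> \<le> (\<Sum>x\<in>K. 2 * sqdist d x \<mu> + 2 * phi d x C)"
      by (intro sum_mono) (metis C phi_triangle sqdist_commute)
    also have "\<dots> = 2 * Opt + 2 * phiS d K C"
      by (simp add: sum.distrib sum_distrib_left O phiS_def)
    finally show ?thesis using small by simp
  qed
  have "(\<Sum>x\<in>K. phi d x C * phiS d K (insert x C))
      \<le> (\<Sum>x\<in>K. 2 * ?m * (\<Sum>y\<in>K. sqdist d y x) + 2 * phiS d K C * sqdist d x \<mu>)"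
  proof (intro sum_mono)
    fix x assume "x \<in> K"
    have a: "phiS d K (insert x C) \<le> (\<Sum>y\<in>K. sqdist d y x)"
      unfolding phiS_def using C by (intro sum_mono) (simp add: phi_insert)
    have b: "phiS d K (insert x C) \<le> phiS d K C" using C by (rule phiS_insert_le)
    have z: "0 \<le> phiS d K (insert x C)" using C by (simp add: phiS_nonneg)
    have "phi d x C * phiS d K (insert x C) \<le> (2 * sqdist d x \<mu> + 2 * ?m) * phiS d K (insert x C)"
      using z phi_triangle[OF C] by (intro mult_right_mono) auto
    also have "\<dots> = 2 * sqdist d x \<mu> * phiS d K (insert x C) + 2 * ?m * phiS d K (insert x C)"
      by (simp add: algebra_simps)
    also have "\<dots> \<le> 2 * sqdist d x \<mu> * phiS d K C + 2 * ?m * (\<Sum>y\<in>K. sqdist d y x)"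
      using a b m0 by (intro add_mono mult_left_mono) auto
    finally show "phi d x C * phiS d K (insert x C)
        \<le> 2 * ?m * (\<Sum>y\<in>K. sqdist d y x) + 2 * phiS d K C * sqdist d x \<mu>"
      by (simp add: algebra_simps)
  qed
  also have "\<dots> = 2 * ?m * (\<Sum>x\<in>K. \<Sum>y\<in>K. sqdist d y x) + 2 * phiS d K C * Opt"
    by (simp add: sum.distrib sum_distrib_left O)
  also have "\<dots> \<le> 2 * ?m * (4 * real (card K) * Opt) + 2 * phiS d K C * Opt"
    using sum_sqdist_pairs_le[OF K, of d \<mu>] m0 by (intro add_right_mono mult_left_mono) (auto simp: O)
  also have "\<dots> = 8 * (real (card K) * ?m) * Opt + 2 * phiS d K C * Opt" by simp
  also have "\<dots> \<le> 8 * (3 * phiS d K C) * Opt + 2 * phiS d K C * Opt"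
    using m O0 by (intro add_mono mult_right_mono mult_left_mono) auto
  finally show ?thesis by (simp add: mult_ac)
qed

text \<open>Greedy \<open>k\<close>-means++ enters the analysis only through the following properties of the
  law \<open>w\<close> of the chosen centre.\<close>

definition greedy_weights ::
    "nat \<Rightarrow> (nat \<Rightarrow> real) set \<Rightarrow> nat \<Rightarrow> (nat \<Rightarrow> real) set \<Rightarrow> ((nat \<Rightarrow> real) \<Rightarrow> real) \<Rightarrow> bool" where
  "greedy_weights d X l C w \<longleftrightarrow>
     (\<forall>x. 0 \<le> w x) \<and> (\<Sum>x\<in>X. w x) = 1 \<and>
     (\<forall>x\<in>X. w x \<le> real l * (phi d x C / phiS d X C)) \<and>
     (\<Sum>x\<in>X. w x * phiS d X (insert x C)) \<le> (\<Sum>x\<in>X. phi d x C / phiS d X C * phiS d X (insert x C)) \<and>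
     (\<forall>A \<theta>. A \<subseteq> X \<longrightarrow> (\<forall>x\<in>A. phiS d X (insert x C) \<le> \<theta>) \<longrightarrow>
        (\<Sum>x | x \<in> X \<and> phiS d X (insert x C) \<le> \<theta>. w x) \<ge> 1/3 \<or>
        (\<Sum>x\<in>A. w x) \<ge> (\<Sum>x\<in>A. phi d x C / phiS d X C) / 2)"

section \<open>D^2 sampling and the law of the greedy choice\<close>

lemma pmf_D2_pmf:
  assumes X: "finite X" and C: "finite C" "C \<noteq> {}" and pos: "phiS d X C > 0"
  shows "pmf (D2_pmf d X C) x = (if x \<in> X then phi d x C / phiS d X C else 0)"
proof -
  let ?f = "\<lambda>x. if x \<in> X then phi d x C / phiS d X C else 0"
  have nn: "\<And>x. 0 \<le> ?f x" using pos phi_nonneg[OF C] by simp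
  have "(\<integral>\<^sup>+ x. ennreal (?f x) \<partial>count_space UNIV) = (\<integral>\<^sup>+ x. ennreal (?f x) \<partial>count_space X)"
    by (rule nn_integral_count_space_eq) auto
  also have "\<dots> = (\<Sum>x\<in>X. ennreal (?f x))" by (rule nn_integral_count_space_finite[OF X])
  also have "\<dots> = ennreal (\<Sum>x\<in>X. ?f x)" using nn by (intro sum_ennreal)
  also have "(\<Sum>x\<in>X. ?f x) = 1" using pos by (simp add: sum_divide_distrib[symmetric] phiS_def[symmetric])
  finally have "(\<integral>\<^sup>+ x. ennreal (?f x) \<partial>count_space UNIV) = 1" by simp
  from pmf_embed_pmf[OF nn this] pos show ?thesis by (simp add: D2_pmf_def)
qed

lemma set_D2_pmf:
  assumes "finite X" "X \<noteq> {}" "finite C" "C \<noteq> {}"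
  shows "set_pmf (D2_pmf d X C) \<subseteq> X"
proof (cases "phiS d X C = 0")
  case True then show ?thesis using assms by (simp add: D2_pmf_def)
next
  case False
  then have "phiS d X C > 0" using phiS_nonneg[of C d X] assms by simp
  then show ?thesis using pmf_D2_pmf[of X C d] assms by (auto simp: set_pmf_iff split: if_splits)
qed

lemma greedy_step_eq:
  "greedy_step d X l C
     = map_pmf (\<lambda>c. insert c C) (greedy_choice (\<lambda>c. phiS d X (insert c C)) l (D2_pmf d X C))"
  by (simp add: greedy_step_def greedy_choice_def pmf.map_comp o_def)

lemma expectation_eq_sum:
  fixes h :: "_ \<Rightarrow> real"
  assumes "finite X" "set_pmf p \<subseteq> X"
  shows "measure_pmf.expectation p h = (\<Sum>x\<in>X. pmf p x * h x)"
  using assms by (subst integral_measure_pmf[of X]) (auto simp: set_pmf_iff)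

lemma greedy_weights_greedy_choice:
  assumes X: "finite X" "X \<noteq> {}" and C: "finite C" "C \<noteq> {}" and pos: "phiS d X C > 0" and l: "l \<ge> 1"
  shows "greedy_weights d X l C (pmf (greedy_choice (\<lambda>c. phiS d X (insert c C)) l (D2_pmf d X C)))"
proof -
  let ?f = "\<lambda>c. phiS d X (insert c C)"
  let ?p = "D2_pmf d X C" let ?g = "greedy_choice ?f l ?p"
  note pmfD = pmf_D2_pmf[OF X(1) C pos]
  have sp: "set_pmf ?p \<subseteq> X" using set_D2_pmf X C by blast
  then have sg: "set_pmf ?g \<subseteq> X" using set_greedy_choice[OF l, of ?f ?p] by blast
  have 1: "(\<Sum>x\<in>X. pmf ?g x) = 1" using sum_pmf_eq_1[OF X(1) sg] .
  have 2: "pmf ?g x \<le> real l * (phi d x C / phiS d X C)" if "x \<in> X" for x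
    using pmf_greedy_choice_le[OF l, of ?f ?p x] that by (simp add: pmfD)
  have 3: "(\<Sum>x\<in>X. pmf ?g x * ?f x) \<le> (\<Sum>x\<in>X. phi d x C / phiS d X C * ?f x)"
    using expectation_greedy_choice_le[OF l, of ?p ?f] finite_subset[OF sp X(1)]
    by (simp add: expectation_eq_sum[OF X(1) sp] expectation_eq_sum[OF X(1) sg] pmfD cong: sum.cong)
  have 4: "(\<Sum>x | x \<in> X \<and> ?f x \<le> \<theta>. pmf ?g x) \<ge> 1/3 \<or>
        (\<Sum>x\<in>A. pmf ?g x) \<ge> (\<Sum>x\<in>A. phi d x C / phiS d X C) / 2"
    if A: "A \<subseteq> X" "\<forall>x\<in>A. ?f x \<le> \<theta>" for A \<theta>
  proof -
    have fA: "finite A" using A(1) X(1) finite_subset by blast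
    have "measure_pmf.prob ?g {x. ?f x \<le> \<theta>} = measure_pmf.prob ?g {x \<in> X. ?f x \<le> \<theta>}"
      using sg by (intro measure_pmf.finite_measure_eq_AE) (auto simp: AE_measure_pmf_iff)
    also have "\<dots> = (\<Sum>x | x \<in> X \<and> ?f x \<le> \<theta>. pmf ?g x)"
      using X by (intro measure_measure_pmf_finite) auto
    finally have a: "measure_pmf.prob ?g {x. ?f x \<le> \<theta>} = (\<Sum>x | x \<in> X \<and> ?f x \<le> \<theta>. pmf ?g x)" .
    have b: "measure_pmf.prob ?p A = (\<Sum>x\<in>A. phi d x C / phiS d X C)"
      unfolding measure_measure_pmf_finite[OF fA] using A(1) by (intro sum.cong) (auto simp: pmfD)
    show ?thesis
      using greedy_choice_dichotomy[OF l, of A ?f \<theta> ?p] A(2)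
      unfolding a b unfolding measure_measure_pmf_finite[OF fA] by blast
  qed
  show ?thesis unfolding greedy_weights_def using 1 2 3 4 by auto
qed

section \<open>The potential of a single cluster\<close>

text \<open>For \<open>t > 0\<close>, the integer \<open>j\<close> with
  \<open>100^j \<le> t < 100^(j+1)\<close>. Since \<open>t\<close> is a squared distance, one level
  is a factor 10 in distance: the next smaller ball around \<open>\<mu>\<close> is small compared
  with the distance from \<open>\<mu>\<close> to the centres.\<close>

definition level :: "real \<Rightarrow> int" where "level t = \<lfloor>log 100 t\<rfloor>"

definition rho :: "int \<Rightarrow> real" where "rho j = 100 powr real_of_int j"

lemma rho_pos [simp]: "0 < rho j"
  by (simp add: rho_def)

lemma rho_minus_1: "rho (j - 1) = rho j / 100"
  by (simp add: rho_def powr_diff)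

lemma rho_mono: "i \<le> j \<Longrightarrow> rho i \<le> rho j"
  by (simp add: rho_def)

lemma rho_level_le:
  assumes "t > 0" shows "rho (level t) \<le> t" "t < 100 * rho (level t)"
proof -
  have t: "100 powr (log 100 t) = t" using assms by simp
  have "100 powr real_of_int (level t) \<le> 100 powr (log 100 t)"
    unfolding level_def by (intro powr_mono) auto
  then show "rho (level t) \<le> t" by (simp add: t rho_def)
  have "100 powr (log 100 t) < 100 powr (1 + real_of_int (level t))"
    unfolding level_def by (intro powr_less_mono) linarith+
  then show "t < 100 * rho (level t)" by (simp add: t rho_def powr_add)
qed

lemma level_less: "t > 0 \<Longrightarrow> t < rho j \<Longrightarrow> level t < j"
  using rho_level_le(1)[of t] rho_mono[of j "level t"] by linarith

lemma level_mono: "0 < s \<Longrightarrow> s \<le> t \<Longrightarrow> level s \<le> level t"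
  by (simp add: level_def floor_mono)

section \<open>One cluster: its core, balls and potential\<close>

locale cluster =
  fixes d :: nat and X K :: "(nat \<Rightarrow> real) set" and \<mu> :: "nat \<Rightarrow> real" and k l :: nat
  assumes X: "finite X" and KX: "K \<subseteq> X" and k: "k \<ge> 2" and l: "l \<ge> 1"
begin

definition "Opt = (\<Sum>x\<in>K. sqdist d x \<mu>)"
text \<open>The factor \<open>1 + ln k\<close> ensures that a D^2 sample from an unsolved cluster
  leaves in expectation at most a \<open>1 / (1 + ln k)\<close> fraction of its cost;
  \<open>10^5\<close> puts the core inside the ball at scale \<open>lev C - 1\<close>.\<close>

definition "tau = 10^5 * (1 + ln (real k))"
definition "solved C \<longleftrightarrow> C \<inter> K \<noteq> {} \<or> phiS d K C \<le> tau * Opt"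
definition "core = {x \<in> K. sqdist d x \<mu> * real (card K) \<le> 2 * Opt}"
definition "muball j = {x \<in> X. sqdist d x \<mu> < rho j}"
text \<open>The share of the ball taken by the core, once the ball contains it. It is at most 1 and
  grows as the scale shrinks, so it measures progress through the scales.\<close>

definition "beta j = real (card core) / real (card (muball j))"
definition "lev C = level (phi d \<mu> C)"
definition "M = 15 * ln (real k)"
text \<open>Equivalently \<open>min (ln k) (ln (8 / eta C))\<close> when all quantities are
  positive. Where the cap is active, \<open>eta C \<le> 8 / k\<close>, which is cheap enough to be
  paid in each of \<open>k\<close> steps.\<close>

definition "slack C = min (ln (real k)) (ln (8 * phiS d X C / (real (card core) * rho (lev C))))"
text \<open>The potential paying for the expected sum of \<open>eta\<close> while the cluster is unsolved. A large drop of
  the total cost is paid by \<open>slack\<close>. A choice closer to \<open>\<mu>\<close> may reset \<open>slack\<close> to \<open>ln k\<close>, but it shrinks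
  the balls around \<open>\<mu>\<close> and thereby increases \<open>beta\<close>. The ball at scale \<open>lev C - 1\<close> is the one whose
  points all lower the cost by a constant fraction of the cost of the ball; the ball at scale
  \<open>lev C\<close> contains all points whose choice changes \<open>lev\<close>, hence the two terms.\<close>
definition "Psi C = (400 * real l * M\<^sup>2 + M) * (1 - beta (lev C)) + 2 * M * (1 - beta (lev C - 1))
   + 15 * slack C * beta (lev C - 1) + 15"
text \<open>Here \<open>15600 = 26 * 600\<close>, with 26 from the D^2 sample and 600 from
  \<open>phiS d K C \<le> 600 * card core * rho (lev C)\<close>.\<close>

definition "G = 15600 * real l * Opt"
text \<open>\<open>tau * Opt\<close> covers becoming solved without a hit and
  \<open>G * Psi C\<close> the expected cost left by a hit. Once \<open>K\<close> is solved, its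
  actual cost takes over.\<close>

definition "V C = (if solved C then phiS d K C else tau * Opt + G * Psi C)"
text \<open>For unsolved \<open>K\<close> this is the share of \<open>K\<close> in the total cost up
  to constant factors. The numerator changes only with \<open>lev C\<close>, so between changes of
  scale only the total cost matters.\<close>

definition "eta C = real (card core) * rho (lev C) / phiS d X C"

text \<open>Points whose choice as a centre moves \<open>lev\<close> down but keeps almost all of the ball
  \<open>muball (lev C)\<close>.\<close>
definition "close C = {x \<in> muball (lev C). 0 < sqdist d x \<mu> \<and>
   real (card (muball (level (sqdist d x \<mu>)))) > real (card (muball (lev C))) * (1 - 1 / (400 * real l * M))}"

lemma finK: "finite K" using X KX finite_subset by blast
lemma fin_muball [simp]: "finite (muball j)" using X by (simp add: muball_def)
lemma Opt_nonneg: "0 \<le> Opt" by (simp add: Opt_def sum_nonneg)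
lemma ln_k_pos: "0 < ln (real k)" using k by simp
lemma M_pos: "0 < M" using ln_k_pos by (simp add: M_def)
lemma G_nonneg: "0 \<le> G" using Opt_nonneg by (simp add: G_def)
lemma tau_ge: "10^5 \<le> tau" using ln_k_pos by (simp add: tau_def)

lemma card_muball_mono: "i \<le> j \<Longrightarrow> card (muball i) \<le> card (muball j)"
  using X by (intro card_mono) (auto simp: muball_def intro: less_le_trans rho_mono)

text \<open>Markov's inequality, with the case \<open>Opt = 0\<close> apart because the bound is
  divided by \<open>Opt\<close>.\<close>

lemma card_core: "card K \<le> 2 * card core"
proof (cases "Opt = 0")
  case True
  then have "\<forall>x\<in>K. sqdist d x \<mu> = 0"
    using sum_nonneg_eq_0_iff[OF finK, of "\<lambda>x. sqdist d x \<mu>"] by (simp add: Opt_def)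
  then have "core = K" by (auto simp: core_def True)
  then show ?thesis by simp
next
  case False
  then have pos: "Opt > 0" using Opt_nonneg by simp
  have cs: "core \<subseteq> K" by (auto simp: core_def)
  have "real (card (K - core)) * (2 * Opt) = (\<Sum>x\<in>K - core. 2 * Opt)" by simp
  also have "\<dots> \<le> (\<Sum>x\<in>K - core. sqdist d x \<mu> * real (card K))"
    by (intro sum_mono) (auto simp: core_def)
  also have "\<dots> \<le> (\<Sum>x\<in>K. sqdist d x \<mu> * real (card K))"
    using finK by (intro sum_mono2) auto
  also have "\<dots> = Opt * real (card K)" by (simp add: Opt_def sum_distrib_right)
  finally have "2 * real (card (K - core)) \<le> real (card K)" using pos by (simp add: mult_ac)
  then have "2 * card (K - core) \<le> card K" by linarith
  then show ?thesis using finK cs by (simp add: card_Diff_subset finite_subset card_mono)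
qed

section \<open>Geometry and drift while the cluster is unsolved\<close>

context
  fixes C
  assumes C: "finite C" "C \<noteq> {}" and unsolved: "\<not> solved C"
begin

lemma cost_K: "10^5 * Opt \<le> phiS d K C" "0 < phiS d K C" "2 * Opt \<le> phiS d K C"
proof -
  have a: "tau * Opt < phiS d K C" using unsolved by (auto simp: solved_def)
  have b: "10^5 * Opt \<le> tau * Opt" using tau_ge Opt_nonneg by (rule mult_right_mono)
  show c: "10^5 * Opt \<le> phiS d K C" "0 < phiS d K C" using a b Opt_nonneg by auto
  show "2 * Opt \<le> phiS d K C" using c Opt_nonneg by auto
qed

lemma cost_pos: "0 < phiS d X C"
  using cost_K(2) phiS_mono[OF X KX C] by (rule less_le_trans)

lemma K_nonempty: "0 < card K"
proof (rule ccontr)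
  assume "\<not> 0 < card K" then have "K = {}" using finK by simp
  then show False using cost_K(2) by (simp add: phiS_def)
qed

text \<open>The weak triangle inequality is averaged over \<open>K\<close>; since \<open>Opt\<close>
  is tiny against the cost of \<open>K\<close>, the point \<open>\<mu>\<close> itself must be far
  from all centres.\<close>

lemma phi_mu:
  shows "phiS d K C \<le> 3 * real (card K) * phi d \<mu> C" "2 * 10^4 * Opt \<le> real (card K) * phi d \<mu> C"
    and "0 < phi d \<mu> C"
proof -
  have "phiS d K C \<le> (\<Sum>x\<in>K. 2 * sqdist d x \<mu> + 2 * phi d \<mu> C)"
    unfolding phiS_def by (intro sum_mono phi_triangle C)
  also have "\<dots> = 2 * Opt + 2 * (real (card K) * phi d \<mu> C)"
    by (simp add: sum.distrib sum_distrib_left Opt_def)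
  finally have a: "phiS d K C \<le> 2 * Opt + 2 * (real (card K) * phi d \<mu> C)" .
  then show "phiS d K C \<le> 3 * real (card K) * phi d \<mu> C" "2 * 10^4 * Opt \<le> real (card K) * phi d \<mu> C"
    using cost_K Opt_nonneg by auto
  then have "0 < real (card K) * phi d \<mu> C" using cost_K by simp
  then show "0 < phi d \<mu> C" using K_nonempty by (simp add: zero_less_mult_iff)
qed

lemma rho_lev: "rho (lev C) \<le> phi d \<mu> C" "phi d \<mu> C < 100 * rho (lev C)"
  unfolding lev_def using rho_level_le[OF phi_mu(3)] by auto

text \<open>A core point has squared distance at most \<open>2 * Opt / card K\<close>, hence at most
  \<open>phi d \<mu> C / 10^4\<close>, and \<open>phi d \<mu> C < 100 * rho (lev C)\<close>.\<close>

lemma core_subset: "core \<subseteq> muball (lev C - 1)"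
proof
  fix x assume x: "x \<in> core"
  then have "sqdist d x \<mu> * real (card K) \<le> 2 * Opt" by (simp add: core_def)
  also have "\<dots> \<le> phi d \<mu> C / 10^4 * real (card K)" using phi_mu(2) by (simp add: mult.commute)
  finally have "sqdist d x \<mu> \<le> phi d \<mu> C / 10^4" using K_nonempty by simp
  also have "\<dots> < rho (lev C - 1)" using rho_lev by (simp add: rho_minus_1)
  finally show "x \<in> muball (lev C - 1)" using x KX by (auto simp: muball_def core_def)
qed

lemma core_pos: "0 < card core"
  using card_core K_nonempty by linarith

lemma card_muball_pos: "lev C - 1 \<le> i \<Longrightarrow> 0 < card (muball i)"
  using card_mono[OF fin_muball core_subset] core_pos card_muball_mono[of "lev C - 1" i] by linarith

lemma beta_facts:
  shows "beta (lev C - 1) \<le> 1" "0 < beta (lev C)" "beta (lev C) \<le> beta (lev C - 1)"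
    and "beta (lev C) * real (card (muball (lev C))) = real (card core)"
    and "beta (lev C - 1) * real (card (muball (lev C - 1))) = real (card core)"
proof -
  have 1: "card core \<le> card (muball (lev C - 1))" using card_mono[OF fin_muball core_subset] .
  have 2: "0 < card (muball (lev C - 1))" "0 < card (muball (lev C))" using card_muball_pos by auto
  have 3: "card (muball (lev C - 1)) \<le> card (muball (lev C))" by (rule card_muball_mono) simp
  show "beta (lev C - 1) \<le> 1" using 1 2 by (simp add: beta_def divide_simps)
  show "0 < beta (lev C)" using core_pos 2 by (simp add: beta_def)
  show "beta (lev C) \<le> beta (lev C - 1)" using 2 3 by (auto simp: beta_def intro!: divide_left_mono)
  show "beta (lev C) * real (card (muball (lev C))) = real (card core)"
    "beta (lev C - 1) * real (card (muball (lev C - 1))) = real (card core)"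
    using 2 by (auto simp: beta_def)
qed

lemma phi_muball:
  assumes "x \<in> muball (lev C - 1)" shows "49/100 * rho (lev C) \<le> phi d x C"
proof -
  have "phi d \<mu> C \<le> 2 * sqdist d \<mu> x + 2 * phi d x C" by (rule phi_triangle[OF C])
  moreover have "sqdist d \<mu> x < rho (lev C) / 100"
    using assms by (simp add: muball_def rho_minus_1 sqdist_commute)
  ultimately show "49/100 * rho (lev C) \<le> phi d x C"
    using rho_lev by auto
qed

lemma cost_ge: "49/100 * (real (card (muball (lev C - 1))) * rho (lev C)) \<le> phiS d X C"
proof -
  have "49/100 * (real (card (muball (lev C - 1))) * rho (lev C)) = (\<Sum>x\<in>muball (lev C - 1). 49/100 * rho (lev C))"
    by simp
  also have "\<dots> \<le> phiS d (muball (lev C - 1)) C"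
    unfolding phiS_def by (intro sum_mono phi_muball)
  also have "\<dots> \<le> phiS d X C" by (rule phiS_mono[OF X _ C]) (auto simp: muball_def)
  finally show ?thesis .
qed

text \<open>Points of the inner ball have pairwise squared distance at most
  \<open>4/100 * rho (lev C)\<close>, while each costs at least \<open>49/100 * rho (lev C)\<close>
  before the choice.\<close>

lemma muball_choice_drop:
  assumes x: "x \<in> muball (lev C - 1)"
  shows "phiS d X (insert x C) \<le> phiS d X C - 2/5 * real (card (muball (lev C - 1))) * rho (lev C)"
proof -
  let ?B = "muball (lev C - 1)"
  have BX: "?B \<subseteq> X" by (auto simp: muball_def)
  have "phi d y (insert x C) \<le> phi d y C - (if y \<in> ?B then 2/5 * rho (lev C) else 0)" if "y \<in> X" for y
  proof (cases "y \<in> ?B")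
    case True
    have "phi d y (insert x C) \<le> sqdist d y x" using C by (simp add: phi_insert)
    also have "\<dots> \<le> 2 * sqdist d y \<mu> + 2 * sqdist d \<mu> x" by (rule sqdist_triangle)
    also have "\<dots> \<le> 4 * (rho (lev C) / 100)"
      using x True by (simp add: muball_def rho_minus_1 sqdist_commute)
    finally have "phi d y (insert x C) \<le> 4 * (rho (lev C) / 100)" .
    moreover have "4 * (rho (lev C) / 100) \<le> 49/100 * rho (lev C) - 2/5 * rho (lev C)"
      using rho_pos[of "lev C"] by simp
    ultimately have "phi d y (insert x C) \<le> phi d y C - 2/5 * rho (lev C)"
      using phi_muball[OF True] by linarith
    then show ?thesis using True by simp
  next
    case False then show ?thesis using C by (simp add: phi_insert)
  qed
  then have "phiS d X (insert x C) \<le> (\<Sum>y\<in>X. phi d y C - (if y \<in> ?B then 2/5 * rho (lev C) else 0))"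
    unfolding phiS_def by (rule sum_mono)
  also have "\<dots> = phiS d X C - (\<Sum>y\<in>X. if y \<in> ?B then 2/5 * rho (lev C) else 0)"
    by (simp add: sum_subtractf phiS_def)
  also have "(\<Sum>y\<in>X. if y \<in> ?B then 2/5 * rho (lev C) else 0) = (\<Sum>y\<in>?B. 2/5 * rho (lev C))"
    using X BX by (simp add: sum.If_cases Int_absorb1)
  finally show ?thesis by simp
qed

lemma eta_bounds: "0 \<le> eta C" "49/100 * eta C \<le> 1"
proof -
  show "0 \<le> eta C" using cost_pos by (simp add: eta_def less_imp_le)
  have "49/100 * (real (card core) * rho (lev C)) \<le> 49/100 * (real (card (muball (lev C - 1))) * rho (lev C))"
    using card_mono[OF fin_muball core_subset] less_imp_le[OF rho_pos] by (intro mult_left_mono mult_right_mono) auto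
  then have "49/100 * (real (card core) * rho (lev C)) \<le> phiS d X C" using cost_ge by (rule order_trans)
  then show "49/100 * eta C \<le> 1" using cost_pos by (simp add: eta_def divide_simps)
qed

lemma phi_muball_le:
  assumes "x \<in> muball (lev C)" shows "phi d x C \<le> 400 * rho (lev C)"
  using phi_triangle[OF C, of d x \<mu>] assms rho_lev by (simp add: muball_def)

text \<open>From \<open>49/100 * eta C \<le> 1\<close> follows
  \<open>8 / eta C \<ge> 98/25 > e\<close>: the factor 8 makes the logarithm at least 1, enough to
  pay for a drop of relative size at most 1.\<close>

lemma slack_ge: "0 \<le> slack C" "8 * phiS d X C / (real (card core) * rho (lev C)) < real k \<Longrightarrow> 1 \<le> slack C"
proof -
  let ?q = "8 * phiS d X C / (real (card core) * rho (lev C))"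
  have p: "0 < real (card core) * rho (lev C)" using core_pos by simp
  have "98/25 * (real (card core) * rho (lev C)) \<le> 8 * phiS d X C"
    using eta_bounds(2) cost_pos by (simp add: eta_def divide_simps mult.commute)
  then have "98/25 \<le> ?q" using p by (simp only: pos_le_divide_eq)
  then have q: "exp 1 \<le> ?q" using exp_le by linarith
  have one: "1 \<le> ln ?q" using q by (subst ln_ge_iff) (auto intro: less_le_trans[OF exp_gt_zero])
  then show "0 \<le> slack C" using ln_k_pos by (simp add: slack_def)
  assume "?q < real k"
  then have "ln ?q < ln (real k)" using q k by (subst ln_less_cancel_iff) (auto intro: less_le_trans[OF exp_gt_zero])
  then show "1 \<le> slack C" using one by (simp add: slack_def)
qed

lemma slack_le: "slack C \<le> ln (real k)" by (simp add: slack_def)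

lemma Psi_ge: "15 \<le> Psi C"
  using beta_facts slack_ge(1) M_pos by (simp add: Psi_def)

lemma Psi_le: "Psi C \<le> 400 * real l * M\<^sup>2 + 4 * M + 15"
proof -
  have "(400 * real l * M\<^sup>2 + M) * (1 - beta (lev C)) \<le> (400 * real l * M\<^sup>2 + M) * 1"
    using M_pos beta_facts by (intro mult_left_mono) auto
  moreover have "2 * M * (1 - beta (lev C - 1)) \<le> 2 * M * 1"
    using M_pos beta_facts by (intro mult_left_mono) auto
  moreover have "15 * slack C * beta (lev C - 1) \<le> M * 1"
    unfolding M_def using beta_facts slack_ge slack_le ln_k_pos by (intro mult_mono) auto
  ultimately have "Psi C \<le> (400 * real l * M\<^sup>2 + M) * 1 + 2 * M * 1 + M * 1 + 15"
    unfolding Psi_def by (intro add_mono order_refl)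
  then show ?thesis by simp
qed


text \<open>Let \<open>x\<close> be the point of \<open>close C\<close> nearest to
  \<open>\<mu>\<close>. The ball at the level of \<open>x\<close> reaches no further than
  \<open>x\<close>, so it misses \<open>close C\<close>; yet it holds almost all of
  \<open>muball (lev C)\<close>. Only the small remainder is left for
  \<open>close C\<close>.\<close>

lemma card_close: "real (card (close C)) \<le> real (card (muball (lev C))) / (400 * real l * M)"
proof (cases "close C = {}")
  case True then show ?thesis using M_pos by simp
next
  case False
  let ?z = "1 / (400 * real l * M)"
  have sub: "close C \<subseteq> muball (lev C)" by (auto simp: close_def)
  then have fin: "finite (close C)" by (rule finite_subset) simp
  obtain x where x: "x \<in> close C" "\<And>y. y \<in> close C \<Longrightarrow> sqdist d x \<mu> \<le> sqdist d y \<mu>"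
    using ex_is_arg_min_if_finite[OF fin False, of "\<lambda>x. sqdist d x \<mu>"]
    by (auto simp: is_arg_min_linorder)
  let ?i = "level (sqdist d x \<mu>)"
  have i: "0 < sqdist d x \<mu>" "?i < lev C"
    "real (card (muball (lev C))) * (1 - ?z) < real (card (muball ?i))"
    using x(1) level_less by (auto simp: close_def muball_def)
  have sub2: "muball ?i \<subseteq> muball (lev C)"
    using i(2) rho_mono[of ?i "lev C"] by (auto simp: muball_def)
  have "muball ?i \<inter> close C = {}"
    using x(2) rho_level_le(1)[OF i(1)] by (fastforce simp: muball_def)
  then have "card (muball ?i) + card (close C) = card (muball ?i \<union> close C)"
    using fin by (simp add: card_Un_disjoint)
  also have "\<dots> \<le> card (muball (lev C))" using sub sub2 by (intro card_mono) auto
  finally have "real (card (close C)) \<le> real (card (muball (lev C))) - real (card (muball ?i))" by linarith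
  also have "\<dots> \<le> real (card (muball (lev C))) * ?z" using i(3) by (simp add: algebra_simps)
  finally show ?thesis by simp
qed

text \<open>If \<open>lev\<close> stays, only \<open>slack\<close> changes, and the fall of the
  logarithm of the total cost gives \<open>6 * eta C\<close>. If \<open>lev\<close> falls,
  \<open>slack\<close> may be reset to \<open>ln k\<close>, but the \<open>1 - beta\<close> terms
  shrink and pay for it, except for \<open>M * beta (lev C)\<close> when \<open>x\<close> is in
  \<open>close C\<close>. At the cap, \<open>slack C\<close> is already \<open>ln k\<close> and the
  reset is free.\<close>

lemma Psi_insert:
  assumes x: "x \<in> X" and unsolved': "\<not> solved (insert x C)"
  shows "8 * phiS d X C / (real (card core) * rho (lev C)) < real k \<Longrightarrow>
      Psi (insert x C) \<le> Psi C + (if x \<in> close C then M * beta (lev C) else 0)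
         - (if phiS d X (insert x C) \<le> phiS d X C - 2/5 * real (card (muball (lev C - 1))) * rho (lev C)
            then 6 * eta C else 0)" (is "?clip \<Longrightarrow> _ \<le> Psi C + ?cl - ?dr")
    and "\<not> 8 * phiS d X C / (real (card core) * rho (lev C)) < real k \<Longrightarrow> Psi (insert x C) \<le> Psi C"
proof -
  let ?C = "insert x C" let ?j = "lev C" let ?j' = "lev (insert x C)"
  let ?F = "phiS d X C" let ?F' = "phiS d X (insert x C)"
  let ?g = "real (card core)"
  let ?D = "2/5 * real (card (muball (?j - 1))) * rho ?j"
  have C': "finite ?C" "?C \<noteq> {}" using C by auto
  note [simp] = C'
  note F = cost_pos
  have F': "0 < ?F'" by (rule cluster.cost_pos[OF cluster_axioms C' unsolved'])
  have FF: "?F' \<le> ?F" using C by (rule phiS_insert_le)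
  have m': "0 < phi d \<mu> ?C" by (rule cluster.phi_mu(3)[OF cluster_axioms C' unsolved'])
  have mm: "phi d \<mu> ?C \<le> phi d \<mu> C" using C by (simp add: phi_insert)
  have jj: "?j' \<le> ?j" unfolding lev_def by (rule level_mono[OF m' mm])
  have gp: "0 < ?g" using core_pos by simp
  have b: "0 < beta ?j" "beta ?j \<le> beta (?j - 1)" by (rule beta_facts)+
  \<comment> \<open>\<open>15 * 2/5 = 6\<close>, and the size of the inner ball cancels against
    \<open>beta\<close>.\<close>
  have drop6: "15 * beta (?j - 1) * (?D / ?F) = 6 * eta C"
  proof -
    have "15 * beta (?j - 1) * (?D / ?F) = 6 * (beta (?j - 1) * real (card (muball (?j - 1)))) * rho ?j / ?F" by simp
    also have "\<dots> = 6 * eta C" unfolding beta_facts(5) by (simp add: eta_def)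
    finally show ?thesis .
  qed
  have cl0: "0 \<le> ?cl" using M_pos b by simp
  have dr: "?dr \<le> 15 * slack C * beta (?j - 1)" if clip: ?clip
  proof -
    have "?D / ?F \<le> 1" using cost_ge F rho_pos[of ?j] by (simp add: divide_simps)
    then have "15 * beta (?j - 1) * (?D / ?F) \<le> 15 * beta (?j - 1) * slack C"
      using slack_ge(2)[OF clip] b by (intro mult_left_mono) auto
    then show ?thesis using drop6 slack_ge(1) b by (simp add: mult_ac)
  qed
  have stay: "Psi ?C \<le> Psi C + 15 * (slack ?C - slack C) * beta (?j - 1)" if "?j' = ?j"
    unfolding Psi_def that by (simp add: algebra_simps)
  \<comment> \<open>The new \<open>slack\<close> is bounded by \<open>ln k\<close>; this uses up
    half of the gain in the \<open>2 * M\<close> term. The new level is at most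
    \<open>lev C - 1\<close>, whence the last inequality.\<close>
  have jump: "Psi ?C \<le> Psi C - (400 * real l * M\<^sup>2 + M) * (beta ?j' - beta ?j) - M * beta (?j' - 1) + 2 * M * beta (?j - 1)
      - 15 * slack C * beta (?j - 1)
    \<and> 0 < beta ?j' \<and> beta ?j' \<le> beta (?j' - 1) \<and> beta (?j - 1) \<le> beta ?j'" if "?j' < ?j"
  proof -
    note b' = cluster.beta_facts[OF cluster_axioms C' unsolved']
    have "15 * slack ?C * beta (?j' - 1) \<le> M * beta (?j' - 1)"
      unfolding M_def using b' cluster.slack_le[OF cluster_axioms C' unsolved'] by (intro mult_right_mono) auto
    moreover have "beta (?j - 1) \<le> beta ?j'"
      unfolding beta_def using card_muball_mono[of ?j' "?j - 1"] that
        cluster.card_muball_pos[OF cluster_axioms C' unsolved', of ?j'] gp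
        card_muball_pos[of "?j - 1"]
      by (intro divide_left_mono) auto
    ultimately show ?thesis using b' unfolding Psi_def by (auto simp: algebra_simps)
  qed
  show "Psi ?C \<le> Psi C + ?cl - ?dr" if clip: ?clip
  proof (cases "?j' = ?j")
    case True
    define q where "q = 8 / (?g * rho ?j)"
    have q: "0 < q" using gp by (simp add: q_def)
    have eq: "8 * y / (?g * rho ?j) = y * q" for y by (simp add: q_def)
    have "ln (?F * q) < ln (real k)"
      using clip q F k unfolding eq by (subst ln_less_cancel_iff) auto
    then have s: "slack C = ln (?F * q)" unfolding slack_def eq by simp
    have s': "slack ?C \<le> ln (?F' * q)" unfolding slack_def True eq by simp
    have d1: "slack ?C - slack C \<le> ln (?F' / ?F)"
      using s s' q F F' by (simp add: ln_mult ln_div)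
    have "slack ?C - slack C \<le> - (if ?F' \<le> ?F - ?D then ?D / ?F else 0)"
    proof -
      have "ln (?F' / ?F) \<le> ?F' / ?F - 1" using F F' by (intro ln_le_minus_one) auto
      moreover have "?F' / ?F \<le> 1" using F FF by simp
      moreover have "?F' / ?F - 1 \<le> - (?D / ?F)" if "?F' \<le> ?F - ?D"
      proof -
        have "?F' / ?F \<le> (?F - ?D) / ?F" using F that by (intro divide_right_mono) auto
        then show ?thesis using F by (simp add: diff_divide_distrib)
      qed
      ultimately show ?thesis using d1 by (auto split: if_splits)
    qed
    then have "15 * (slack ?C - slack C) * beta (?j - 1) \<le> 15 * (- (if ?F' \<le> ?F - ?D then ?D / ?F else 0)) * beta (?j - 1)"
      using b by (intro mult_right_mono mult_left_mono) auto
    also have "\<dots> = - ?dr" using drop6 by (auto simp: mult_ac)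
    finally show ?thesis using stay[OF True] cl0 by linarith
  next
    case False
    then have lt: "?j' < ?j" using jj by simp
    note J = jump[OF lt]
    \<comment> \<open>The level changes only if \<open>x\<close> becomes the centre nearest to
      \<open>\<mu>\<close>.\<close>
    have mx: "phi d \<mu> ?C = sqdist d x \<mu>"
    proof (rule ccontr)
      assume "phi d \<mu> ?C \<noteq> sqdist d x \<mu>"
      then have "phi d \<mu> ?C = phi d \<mu> C" using C by (auto simp: phi_insert sqdist_commute min_def split: if_splits)
      then show False using lt by (simp add: lev_def)
    qed
    have xb: "x \<in> muball ?j"
    proof -
      have "sqdist d x \<mu> < rho ?j"
      proof (rule ccontr)
        assume "\<not> sqdist d x \<mu> < rho ?j"
        then have "rho ?j \<le> phi d \<mu> ?C" by (simp add: mx)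
        also have "\<dots> < 100 * rho ?j'" using rho_level_le(2)[OF m'] by (simp add: lev_def)
        also have "\<dots> \<le> 100 * rho (?j - 1)" using lt by (intro mult_left_mono rho_mono) auto
        finally show False by (simp add: rho_minus_1)
      qed
      then show ?thesis using x by (simp add: muball_def)
    qed
    \<comment> \<open>Outside \<open>close C\<close> the ball loses at least a
      \<open>1 / (400 * l * M)\<close> share of its points, so \<open>beta\<close> grows by at least
      that share of itself, and the quadratic coefficient turns this into
      \<open>M * beta (lev C)\<close>.\<close>
    have "- (400 * real l * M\<^sup>2) * (beta ?j' - beta ?j) + M * beta ?j \<le> ?cl"
    proof (cases "x \<in> close C")
      case True
      then show ?thesis using J b by simp
    next
      case nc: False
      let ?z = "1 / (400 * real l * M)"
      have z0: "0 < ?z" using M_pos l by simp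
      have "real (card (muball ?j')) \<le> real (card (muball ?j)) * (1 - ?z)"
        using nc xb m' by (auto simp: close_def mx lev_def)
      then have "beta ?j' * real (card (muball ?j')) \<le> beta ?j' * (real (card (muball ?j)) * (1 - ?z))"
        using J by (intro mult_left_mono) auto
      then have "beta ?j * real (card (muball ?j)) \<le> beta ?j' * (1 - ?z) * real (card (muball ?j))"
        unfolding beta_facts(4) cluster.beta_facts(4)[OF cluster_axioms C' unsolved'] by (simp add: mult_ac)
      then have "beta ?j \<le> beta ?j' * (1 - ?z)"
        using card_muball_pos[of ?j] by simp
      moreover have "?z * beta ?j \<le> ?z * beta ?j'" using J b z0 by (intro mult_left_mono) auto
      ultimately have "?z * beta ?j \<le> beta ?j' - beta ?j" by (simp add: algebra_simps)
      then have "400 * real l * M\<^sup>2 * (?z * beta ?j) \<le> 400 * real l * M\<^sup>2 * (beta ?j' - beta ?j)"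
        by (intro mult_left_mono) auto
      moreover have "400 * real l * M\<^sup>2 * (?z * beta ?j) = M * beta ?j"
        using l M_pos by (simp add: power2_eq_square)
      ultimately show ?thesis using nc by simp
    qed
    moreover have "- M * beta (?j' - 1) + 2 * M * beta (?j - 1) \<le> M * beta ?j'"
    proof -
      have "M * beta (?j - 1) \<le> M * beta (?j' - 1)" "M * beta (?j - 1) \<le> M * beta ?j'"
        using J M_pos by (auto intro!: mult_left_mono)
      then show ?thesis by simp
    qed
    ultimately show ?thesis using J dr[OF clip] by (simp add: algebra_simps)
  qed
  show "Psi ?C \<le> Psi C" if clip: "\<not> ?clip"
  proof -
    have sC: "slack C = ln (real k)"
      using clip k F gp unfolding slack_def not_less by (intro min_absorb1) (subst ln_le_cancel_iff, auto)
    show ?thesis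
    proof (cases "?j' = ?j")
      case True
      have "slack ?C \<le> slack C" unfolding sC unfolding slack_def by simp
      then have "15 * (slack ?C - slack C) * beta (?j - 1) \<le> 0"
        using b by (intro mult_nonpos_nonneg[of "15 * (slack ?C - slack C)"]) auto
      then show ?thesis using stay[OF True] by simp
    next
      case False
      then have lt: "?j' < ?j" using jj by simp
      note J = jump[OF lt]
      have "0 \<le> (400 * real l * M\<^sup>2 + M) * (beta ?j' - beta ?j)"
        using J b M_pos by (intro mult_nonneg_nonneg) auto
      moreover have "M * beta (?j - 1) \<le> M * beta (?j' - 1)" using J M_pos by (intro mult_left_mono) auto
      moreover have "15 * slack C * beta (?j - 1) = M * beta (?j - 1)" by (simp add: sC M_def)
      ultimately show ?thesis using J by linarith
    qed
  qed
qed


lemma hit_cost_le: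
  assumes w: "greedy_weights d X l C w"
  shows "(\<Sum>x\<in>K. w x * phiS d K (insert x C)) \<le> G * eta C"
proof -
  let ?F = "phiS d X C"
  have "(\<Sum>x\<in>K. w x * phiS d K (insert x C))
      \<le> (\<Sum>x\<in>K. real l / ?F * (phi d x C * phiS d K (insert x C)))"
  proof (intro sum_mono)
    fix x assume "x \<in> K"
    then have "w x \<le> real l * (phi d x C / ?F)" using w KX by (auto simp: greedy_weights_def)
    then have "w x * phiS d K (insert x C) \<le> real l * (phi d x C / ?F) * phiS d K (insert x C)"
      using C by (intro mult_right_mono phiS_nonneg) auto
    then show "w x * phiS d K (insert x C) \<le> real l / ?F * (phi d x C * phiS d K (insert x C))" by simp
  qed
  also have "\<dots> = real l / ?F * (\<Sum>x\<in>K. phi d x C * phiS d K (insert x C))"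
    by (simp add: sum_distrib_left)
  also have "\<dots> \<le> real l / ?F * (26 * phiS d K C * Opt)"
    using D2_weighted_cost_le[OF finK C Opt_def cost_K(3)] cost_pos by (intro mult_left_mono) auto
  also have "\<dots> \<le> real l / ?F * (26 * (600 * real (card core) * rho (lev C)) * Opt)"
  proof -
    have "phiS d K C \<le> 3 * real (card K) * phi d \<mu> C" by (rule phi_mu)
    also have "\<dots> \<le> 3 * (2 * real (card core)) * (100 * rho (lev C))"
      using card_core rho_lev phi_mu(3) by (intro mult_mono) auto
    finally have "phiS d K C \<le> 600 * real (card core) * rho (lev C)" by simp
    then show ?thesis using cost_pos Opt_nonneg by (intro mult_left_mono mult_right_mono) auto
  qed
  also have "\<dots> = G * eta C" by (simp add: G_def eta_def)
  finally show ?thesis .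
qed

text \<open>\<open>close C\<close> has at most a \<open>1 / (400 * l * M)\<close> share of the ball,
  each of its points costs at most \<open>400 * rho (lev C)\<close>, and the greedy choice adds a
  factor \<open>l\<close>; the threshold in \<open>close\<close> is made to cancel these.\<close>

lemma close_weight_le:
  assumes w: "greedy_weights d X l C w"
  shows "M * beta (lev C) * (\<Sum>x\<in>close C. w x) \<le> eta C"
proof -
  let ?F = "phiS d X C"
  have "(\<Sum>x\<in>close C. w x) \<le> (\<Sum>x\<in>close C. real l * (400 * rho (lev C) / ?F))"
  proof (intro sum_mono)
    fix x assume "x \<in> close C"
    then have x: "x \<in> muball (lev C)" "x \<in> X" by (auto simp: close_def muball_def)
    then have "w x \<le> real l * (phi d x C / ?F)" using w by (auto simp: greedy_weights_def)
    also have "\<dots> \<le> real l * (400 * rho (lev C) / ?F)"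
      using phi_muball_le[OF x(1)] cost_pos by (intro mult_left_mono divide_right_mono) auto
    finally show "w x \<le> real l * (400 * rho (lev C) / ?F)" .
  qed
  also have "\<dots> = real (card (close C)) * (real l * (400 * rho (lev C) / ?F))" by simp
  also have "\<dots> \<le> real (card (muball (lev C))) / (400 * real l * M) * (real l * (400 * rho (lev C) / ?F))"
    using card_close cost_pos less_imp_le[OF rho_pos] by (intro mult_right_mono) auto
  also have "\<dots> = real (card (muball (lev C))) * rho (lev C) / (M * ?F)"
    using l by simp
  finally have "M * beta (lev C) * (\<Sum>x\<in>close C. w x)
      \<le> M * beta (lev C) * (real (card (muball (lev C))) * rho (lev C) / (M * ?F))"
    using M_pos beta_facts by (intro mult_left_mono) auto
  also have "\<dots> = (beta (lev C) * real (card (muball (lev C)))) * rho (lev C) / ?F"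
    using M_pos by simp
  also have "\<dots> = eta C" unfolding beta_facts(4) by (simp add: eta_def)
  finally show ?thesis .
qed

text \<open>Hits in \<open>K\<close> and choices in \<open>close C\<close> each cost at most
  \<open>G * eta C\<close> in expectation. By the dichotomy, either a drop worth
  \<open>6 * G * eta C\<close> has probability at least 1/3, or a core point is chosen with
  probability at least \<open>49/200 * eta C\<close> and releases at least \<open>15 * G\<close>;
  both pay for the two charges. At the cap of \<open>slack\<close>, the hit charge is at most
  \<open>8 * G / k\<close> and is simply added.\<close>

lemma V_step_unsolved:
  assumes w: "greedy_weights d X l C w"
  shows "(\<Sum>x\<in>X. w x * V (insert x C)) \<le> V C + 8 * G / real k"
proof -
  let ?F = "phiS d X C"
  define T where "T = tau * Opt + G * Psi C"
  define P where "P x \<longleftrightarrow> phiS d X (insert x C) \<le> ?F - 2/5 * real (card (muball (lev C - 1))) * rho (lev C)" for x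
  have w0: "0 \<le> w x" for x using w by (simp add: greedy_weights_def)
  have w1: "(\<Sum>x\<in>X. w x) = 1" using w by (simp add: greedy_weights_def)
  have VC: "V C = T" using unsolved by (simp add: V_def T_def)
  have e0: "0 \<le> eta C" "49/100 * eta C \<le> 1" by (rule eta_bounds)+
  have tO: "0 \<le> tau * Opt" using tau_ge Opt_nonneg by simp
  have T15: "G * 15 \<le> T" using mult_left_mono[OF Psi_ge G_nonneg] tO by (simp add: T_def)
  have hit: "(\<Sum>x\<in>X. if x \<in> K then w x * phiS d K (insert x C) else 0) \<le> G * eta C"
    using hit_cost_le[OF w] X KX by (simp add: sum.If_cases Int_absorb1)
  have VK: "V (insert x C) = phiS d K (insert x C)" if "x \<in> K" for x
    using that by (simp add: V_def solved_def)
  have Vs: "V (insert x C) \<le> tau * Opt" if "x \<notin> K" "solved (insert x C)" for x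
    using that unsolved by (auto simp: V_def solved_def)
  show ?thesis
  proof (cases "8 * ?F / (real (card core) * rho (lev C)) < real k")
    case False
    have "V (insert x C) \<le> T" if "x \<in> X" "x \<notin> K" for x
    proof (cases "solved (insert x C)")
      case True then show ?thesis using Vs that T15 G_nonneg Psi_ge unfolding T_def
        by (smt (verit) mult_nonneg_nonneg)
    next
      case ns: False
      then show ?thesis using mult_left_mono[OF Psi_insert(2)[OF that(1) ns False] G_nonneg]
        by (simp add: V_def T_def)
    qed
    then have "w x * V (insert x C) \<le> (if x \<in> K then w x * phiS d K (insert x C) else 0) + w x * T" if "x \<in> X" for x
      using that w0 VK T15 G_nonneg by (auto intro: mult_left_mono)
    then have "(\<Sum>x\<in>X. w x * V (insert x C))
        \<le> (\<Sum>x\<in>X. (if x \<in> K then w x * phiS d K (insert x C) else 0) + w x * T)"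
      by (rule sum_mono)
    also have "\<dots> \<le> G * eta C + T"
      using hit w1 by (simp add: sum.distrib sum_distrib_right[symmetric])
    also have "G * eta C \<le> G * (8 / real k)"
    proof (intro mult_left_mono G_nonneg)
      have "0 < real (card core) * rho (lev C)" using core_pos by simp
      then have "real k * (real (card core) * rho (lev C)) \<le> 8 * ?F"
        using False by (simp add: not_less pos_le_divide_eq)
      then show "eta C \<le> 8 / real k"
        using cost_pos k by (simp add: eta_def divide_simps mult_ac)
    qed
    finally show ?thesis by (simp add: VC mult.commute add.commute)
  next
    case clip: True
    have Vn: "V (insert x C) \<le> T + (if x \<in> close C then G * (M * beta (lev C)) else 0) - (if P x then G * (6 * eta C) else 0)"
      if "x \<in> X" "x \<notin> K" for x
    proof (cases "solved (insert x C)")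
      case True
      have "6 * eta C \<le> Psi C" using e0 Psi_ge by linarith
      then have "G * (6 * eta C) \<le> G * Psi C" using G_nonneg by (rule mult_left_mono)
      moreover have "0 \<le> G * Psi C" using G_nonneg Psi_ge by simp
      moreover have "0 \<le> G * (M * beta (lev C))" using G_nonneg M_pos beta_facts(2) by simp
      ultimately show ?thesis using Vs[OF that(2) True] by (auto simp: T_def)
    next
      case ns: False
      then show ?thesis
        using mult_left_mono[OF Psi_insert(1)[OF that(1) ns clip] G_nonneg]
        by (auto simp: V_def T_def P_def algebra_simps split: if_splits)
    qed
    have close: "(\<Sum>x\<in>X. if x \<in> close C then w x * (G * (M * beta (lev C))) else 0) \<le> G * eta C"
    proof -
      have "close C \<subseteq> X" by (auto simp: close_def muball_def)
      then have "(\<Sum>x\<in>X. if x \<in> close C then w x * (G * (M * beta (lev C))) else 0)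
          = (\<Sum>x\<in>close C. w x) * (G * (M * beta (lev C)))"
        using X by (simp add: sum.If_cases Int_absorb1 sum_distrib_right)
      also have "\<dots> = G * (M * beta (lev C) * (\<Sum>x\<in>close C. w x))" by (simp add: mult_ac)
      also have "\<dots> \<le> G * eta C" using close_weight_le[OF w] G_nonneg by (rule mult_left_mono)
      finally show ?thesis .
    qed
    have core: "core \<subseteq> X" "core \<subseteq> K" using KX by (auto simp: core_def)
    have "\<forall>x\<in>core. P x" unfolding P_def using core_subset muball_choice_drop by blast
    with w core(1) consider "(\<Sum>x | x \<in> X \<and> P x. w x) \<ge> 1/3"
      | "(\<Sum>x\<in>core. w x) \<ge> (\<Sum>x\<in>core. phi d x C / ?F) / 2"
      unfolding greedy_weights_def P_def by blast
    then show ?thesis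
    proof cases
      case 1
      have "w x * V (insert x C) \<le> (if x \<in> K then w x * phiS d K (insert x C) else 0) + w x * T
          + (if x \<in> close C then w x * (G * (M * beta (lev C))) else 0)
          - (if P x then w x * (G * (6 * eta C)) else 0)" if "x \<in> X" for x
      proof (cases "x \<in> K")
        case True
        \<comment> \<open>The sum over \<open>P\<close> also credits points of \<open>K\<close>,
          where \<open>V\<close> is now the actual cost; the released \<open>T \<ge> 15 * G\<close>
          covers this credit.\<close>
        have "G * (6 * eta C) \<le> G * 15" using e0 G_nonneg by (intro mult_left_mono) auto
        then have "w x * (G * (6 * eta C)) \<le> w x * T" "0 \<le> w x * T"
          using T15 G_nonneg w0 by (auto intro!: mult_left_mono mult_nonneg_nonneg)
        moreover have "0 \<le> w x * (G * (M * beta (lev C)))" using w0 G_nonneg M_pos beta_facts(2) by simp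
        ultimately show ?thesis using True VK[OF True] by auto
      next
        case False
        show ?thesis using mult_left_mono[OF Vn[OF that False] w0[of x]] False
          by (auto simp: algebra_simps)
      qed
      then have "(\<Sum>x\<in>X. w x * V (insert x C))
          \<le> (\<Sum>x\<in>X. (if x \<in> K then w x * phiS d K (insert x C) else 0) + w x * T
          + (if x \<in> close C then w x * (G * (M * beta (lev C))) else 0)
          - (if P x then w x * (G * (6 * eta C)) else 0))" by (rule sum_mono)
      also have "\<dots> = (\<Sum>x\<in>X. if x \<in> K then w x * phiS d K (insert x C) else 0) + T
          + (\<Sum>x\<in>X. if x \<in> close C then w x * (G * (M * beta (lev C))) else 0)
          - (\<Sum>x | x \<in> X \<and> P x. w x) * (G * (6 * eta C))"
        using w1 X by (simp add: sum.distrib sum_subtractf sum_distrib_right[symmetric] sum.If_cases Int_def)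
      also have "\<dots> \<le> G * eta C + T + G * eta C - 1/3 * (G * (6 * eta C))"
      proof -
        have "1/3 * (G * (6 * eta C)) \<le> (\<Sum>x | x \<in> X \<and> P x. w x) * (G * (6 * eta C))"
          using 1 G_nonneg e0(1) by (intro mult_right_mono) auto
        then show ?thesis using hit close by (intro diff_mono add_mono order_refl)
      qed
      also have "\<dots> = V C" by (simp add: VC)
      finally show ?thesis using G_nonneg by (smt (verit) divide_nonneg_nonneg of_nat_0_le_iff)
    next
      case 2
      have "w x * V (insert x C) \<le> (if x \<in> K then w x * phiS d K (insert x C) else 0) + w x * T
          + (if x \<in> close C then w x * (G * (M * beta (lev C))) else 0)
          - (if x \<in> core then w x * T else 0)" if "x \<in> X" for x
      proof (cases "x \<in> K")
        case True
        have "0 \<le> w x * T" using T15 G_nonneg w0 by (auto intro!: mult_nonneg_nonneg)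
        moreover have "0 \<le> w x * (G * (M * beta (lev C)))" using w0 G_nonneg M_pos beta_facts(2) by simp
        ultimately show ?thesis using True VK[OF True] by auto
      next
        case False
        have "0 \<le> w x * (G * (6 * eta C))" using w0 G_nonneg e0 by simp
        then show ?thesis using mult_left_mono[OF Vn[OF that False] w0[of x]] False core(2)
          by (auto simp: algebra_simps split: if_splits)
      qed
      then have "(\<Sum>x\<in>X. w x * V (insert x C))
          \<le> (\<Sum>x\<in>X. (if x \<in> K then w x * phiS d K (insert x C) else 0) + w x * T
          + (if x \<in> close C then w x * (G * (M * beta (lev C))) else 0)
          - (if x \<in> core then w x * T else 0))" by (rule sum_mono)
      also have "\<dots> = (\<Sum>x\<in>X. if x \<in> K then w x * phiS d K (insert x C) else 0) + T
          + (\<Sum>x\<in>X. if x \<in> close C then w x * (G * (M * beta (lev C))) else 0)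
          - (\<Sum>x\<in>core. w x) * T"
        using w1 X core(1) by (simp add: sum.distrib sum_subtractf sum_distrib_right[symmetric] sum.If_cases Int_absorb1)
      also have "\<dots> \<le> G * eta C + T + G * eta C - 49/200 * eta C * (G * 15)"
      proof -
        have "49/100 * eta C = (\<Sum>x\<in>core. 49/100 * rho (lev C) / ?F)" by (simp add: eta_def)
        also have "\<dots> \<le> (\<Sum>x\<in>core. phi d x C / ?F)"
          using core_subset phi_muball cost_pos by (intro sum_mono divide_right_mono) auto
        finally have "49/200 * eta C \<le> (\<Sum>x\<in>core. w x)" using 2 by simp
        then have "49/200 * eta C * (G * 15) \<le> (\<Sum>x\<in>core. w x) * T"
          using T15 G_nonneg e0 w0 by (intro mult_mono sum_nonneg) auto
        then show ?thesis using hit close by (intro diff_mono add_mono order_refl)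
      qed
      also have "\<dots> \<le> T" using mult_nonneg_nonneg[OF G_nonneg e0(1)] by simp
      finally show ?thesis unfolding VC using G_nonneg by (smt (verit) divide_nonneg_nonneg of_nat_0_le_iff)
    qed
  qed
qed

end

lemma V_insert_solved:
  assumes "finite C" "C \<noteq> {}" "solved C" shows "V (insert x C) \<le> V C" "solved (insert x C)"
proof -
  have "phiS d K (insert x C) \<le> phiS d K C" by (rule phiS_insert_le[OF assms(1,2)])
  then show "solved (insert x C)" "V (insert x C) \<le> V C" using assms by (auto simp: solved_def V_def)
qed

end

section \<open>Expectations along the run of the algorithm\<close>

lemma greedy_first_eq:
  "greedy_first d X l = map_pmf (\<lambda>c. {c}) (greedy_choice (\<lambda>c. phiS d X {c}) l (pmf_of_set X))"
  by (simp add: greedy_first_def greedy_choice_def pmf.map_comp o_def)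

lemma greedy_step_sum:
  fixes d :: nat and h :: "_ \<Rightarrow> real"
  assumes "finite X" "X \<noteq> {}" "finite C" "C \<noteq> {}" "l \<ge> 1"
  defines "w \<equiv> pmf (greedy_choice (\<lambda>c. phiS d X (insert c C)) l (D2_pmf d X C))"
  shows "measure_pmf.expectation (greedy_step d X l C) h = (\<Sum>x\<in>X. w x * h (insert x C))"
    and "\<And>x. 0 \<le> w x" "(\<Sum>x\<in>X. w x) = 1"
    and "phiS d X C > 0 \<Longrightarrow> greedy_weights d X l C w"
    and "set_pmf (greedy_step d X l C) \<subseteq> (\<lambda>x. insert x C) ` X"
proof -
  have s: "set_pmf (greedy_choice (\<lambda>c. phiS d X (insert c C)) l (D2_pmf d X C)) \<subseteq> X"
    by (rule subset_trans[OF set_greedy_choice[OF assms(5)] set_D2_pmf[OF assms(1-4)]])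
  show "measure_pmf.expectation (greedy_step d X l C) h = (\<Sum>x\<in>X. w x * h (insert x C))"
    unfolding w_def greedy_step_eq by (simp add: expectation_eq_sum[OF assms(1) s])
  show "\<And>x. 0 \<le> w x" "(\<Sum>x\<in>X. w x) = 1"
    using sum_pmf_eq_1[OF assms(1) s] by (auto simp: w_def)
  show "phiS d X C > 0 \<Longrightarrow> greedy_weights d X l C w"
    unfolding w_def by (rule greedy_weights_greedy_choice[OF assms(1-4) _ assms(5)])
  show "set_pmf (greedy_step d X l C) \<subseteq> (\<lambda>x. insert x C) ` X"
    using s by (auto simp: greedy_step_eq)
qed

lemma set_greedy_first:
  assumes "finite X" "X \<noteq> {}" "l \<ge> 1" shows "set_pmf (greedy_first d X l) \<subseteq> (\<lambda>x. {x}) ` X"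
  using set_greedy_choice[OF assms(3), of "\<lambda>c. phiS d X {c}" "pmf_of_set X"] assms
  by (auto simp: greedy_first_eq)

lemma set_greedy_kmeanspp:
  assumes "finite X" "X \<noteq> {}" "l \<ge> 1"
  shows "set_pmf (greedy_kmeanspp d X l i) \<subseteq> Pow X - {{}}"
proof (induction i)
  case 0 then show ?case using set_greedy_first[OF assms] by auto
next
  case (Suc i)
  show ?case
  proof
    fix C' assume "C' \<in> set_pmf (greedy_kmeanspp d X l (Suc i))"
    then obtain C where C: "C \<in> set_pmf (greedy_kmeanspp d X l i)" "C' \<in> set_pmf (greedy_step d X l C)"
      by auto
    then have "C \<subseteq> X" "C \<noteq> {}" using Suc by auto
    then have "finite C" using assms finite_subset by blast
    from greedy_step_sum(5)[OF assms(1,2) this \<open>C \<noteq> {}\<close> assms(3), of d] C(2)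
    obtain x where "x \<in> X" "C' = insert x C" by blast
    then show "C' \<in> Pow X - {{}}" using \<open>C \<subseteq> X\<close> by simp
  qed
qed

lemma finite_set_greedy_kmeanspp:
  assumes "finite X" "X \<noteq> {}" "l \<ge> 1"
  shows "finite (set_pmf (greedy_kmeanspp d X l i))"
  using set_greedy_kmeanspp[OF assms, of d i] by (rule finite_subset) (use assms in simp)

lemma expectation_greedy_mono:
  fixes f g :: "_ \<Rightarrow> real"
  assumes X: "finite X" "X \<noteq> {}" "l \<ge> 1"
    and le: "\<And>C. finite C \<Longrightarrow> C \<noteq> {} \<Longrightarrow> C \<subseteq> X \<Longrightarrow> f C \<le> g C"
  shows "measure_pmf.expectation (greedy_kmeanspp d X l i) f \<le> measure_pmf.expectation (greedy_kmeanspp d X l i) g"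
proof (rule integral_mono_AE)
  show "AE C in measure_pmf (greedy_kmeanspp d X l i). f C \<le> g C"
    unfolding AE_measure_pmf_iff
  proof
    fix C assume "C \<in> set_pmf (greedy_kmeanspp d X l i)"
    then have "C \<subseteq> X" "C \<noteq> {}" using set_greedy_kmeanspp[OF X, of d i] by auto
    then show "f C \<le> g C" using le finite_subset[OF _ X(1)] by blast
  qed
qed (intro integrable_measure_pmf_finite finite_set_greedy_kmeanspp X)+

text \<open>Conditioning on the current centres turns a one-step bound for fixed \<open>C\<close>
  into a bound for the run.\<close>

lemma expectation_greedy_Suc_le:
  fixes f g :: "_ \<Rightarrow> real"
  assumes X: "finite X" "X \<noteq> {}" "l \<ge> 1"
    and le: "\<And>C. finite C \<Longrightarrow> C \<noteq> {} \<Longrightarrow> C \<subseteq> X \<Longrightarrow>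
       measure_pmf.expectation (greedy_step d X l C) f \<le> g C"
  shows "measure_pmf.expectation (greedy_kmeanspp d X l (Suc i)) f
       \<le> measure_pmf.expectation (greedy_kmeanspp d X l i) g"
proof -
  let ?A = "Pow X - {{}}"
  have fA: "finite ?A" using X by simp
  have fC: "finite C" if "C \<in> ?A" for C using that finite_subset[OF _ X(1)] by simp
  have fs: "finite (set_pmf (greedy_step d X l C))" if "C \<in> ?A" for C
  proof -
    have "C \<noteq> {}" using that by simp
    from finite_subset[OF greedy_step_sum(5)[OF X(1,2) fC[OF that] this X(3)]] X(1)
    show ?thesis by simp
  qed
  have "measure_pmf.expectation (greedy_kmeanspp d X l (Suc i)) f
     = (\<Sum>C\<in>?A. pmf (greedy_kmeanspp d X l i) C *\<^sub>R measure_pmf.expectation (greedy_step d X l C) f)"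
    unfolding greedy_kmeanspp.simps
    using fA fs set_greedy_kmeanspp[OF X, of d i] by (rule pmf_expectation_bind)
  also have "\<dots> \<le> (\<Sum>C\<in>?A. pmf (greedy_kmeanspp d X l i) C * g C)"
  proof (rule sum_mono)
    fix C assume C: "C \<in> ?A"
    then have "measure_pmf.expectation (greedy_step d X l C) f \<le> g C" by (intro le fC) auto
    then show "pmf (greedy_kmeanspp d X l i) C *\<^sub>R measure_pmf.expectation (greedy_step d X l C) f
       \<le> pmf (greedy_kmeanspp d X l i) C * g C" by (simp add: mult_left_mono)
  qed
  also have "\<dots> = measure_pmf.expectation (greedy_kmeanspp d X l i) g"
    by (rule expectation_eq_sum[OF fA set_greedy_kmeanspp[OF X], symmetric])
  finally show ?thesis .
qed

lemma ln_ge_two_thirds: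
  fixes k :: nat
  assumes "k \<ge> 2" shows "2/3 \<le> ln (real k)"
proof -
  have "ln 2 \<le> ln (real k)" using assms by (subst ln_le_cancel_iff) auto
  with ln2_ge_two_thirds show ?thesis by linarith
qed

context cluster
begin

text \<open>\<open>V\<close> is a supermartingale up to \<open>8 * G / k\<close> per step, at most
  \<open>8 * G\<close> in all.\<close>

lemma V_step:
  assumes "X \<noteq> {}" "finite C" "C \<noteq> {}"
  shows "measure_pmf.expectation (greedy_step d X l C) V \<le> V C + 8 * G / real k"
proof (cases "solved C")
  case False
  have "phiS d X C > 0" by (rule cost_pos[OF assms(2,3) False])
  from V_step_unsolved[OF assms(2,3) False greedy_step_sum(4)[OF X assms(1-3) l this]]
  show ?thesis by (simp add: greedy_step_sum(1)[OF X assms(1-3) l])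
next
  case True
  note W = greedy_step_sum[OF X assms l]
  have "measure_pmf.expectation (greedy_step d X l C) V
      \<le> (\<Sum>x\<in>X. pmf (greedy_choice (\<lambda>c. phiS d X (insert c C)) l (D2_pmf d X C)) x * V C)"
    unfolding W(1) using W(2) V_insert_solved(1)[OF assms(2,3) True] by (intro sum_mono mult_left_mono) auto
  also have "\<dots> = V C" using W(3) by (simp add: sum_distrib_right[symmetric])
  also have "0 \<le> 8 * G / real k" using G_nonneg by simp
  then have "V C \<le> V C + 8 * G / real k" by simp
  finally show ?thesis .
qed

text \<open>Each point is the first centre with probability at most \<open>l / card X\<close>, so
  the sum over pairs bounds the case of a hit in \<open>K\<close>; otherwise the maximal potential
  is charged.\<close>

lemma V_first:
  assumes "X \<noteq> {}"
  shows "measure_pmf.expectation (greedy_first d X l) V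
     \<le> 4 * real l * Opt + (tau * Opt + G * (400 * real l * M\<^sup>2 + 4 * M + 15))"
proof -
  let ?g = "greedy_choice (\<lambda>c. phiS d X {c}) l (pmf_of_set X)"
  define T where "T = tau * Opt + G * (400 * real l * M\<^sup>2 + 4 * M + 15)"
  have T0: "tau * Opt \<le> T" "0 \<le> T"
    using tau_ge Opt_nonneg G_nonneg M_pos by (auto simp: T_def)
  have s: "set_pmf ?g \<subseteq> X" using set_greedy_choice[OF l, of "\<lambda>c. phiS d X {c}" "pmf_of_set X"] X assms by simp
  have w: "pmf ?g x \<le> real l / real (card X)" if "x \<in> X" for x
    using pmf_greedy_choice_le[OF l, of "\<lambda>c. phiS d X {c}" "pmf_of_set X" x] X assms that by simp
  have Vle: "V {x} \<le> (if x \<in> K then phiS d K {x} else 0) + T" if "x \<in> X" for x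
  proof (cases "solved {x}")
    case True
    then show ?thesis using T0 by (auto simp: V_def solved_def)
  next
    case False
    then show ?thesis
      using mult_left_mono[OF Psi_le[OF _ _ False] G_nonneg] by (auto simp: V_def T_def solved_def)
  qed
  have "measure_pmf.expectation (greedy_first d X l) V = (\<Sum>x\<in>X. pmf ?g x * V {x})"
    unfolding greedy_first_eq by (simp add: expectation_eq_sum[OF X s])
  also have "\<dots> \<le> (\<Sum>x\<in>X. pmf ?g x * ((if x \<in> K then phiS d K {x} else 0) + T))"
    by (intro sum_mono mult_left_mono Vle) auto
  also have "\<dots> = (\<Sum>x\<in>X. pmf ?g x * (if x \<in> K then phiS d K {x} else 0)) + T"
    using sum_pmf_eq_1[OF X s] by (simp add: distrib_left sum.distrib sum_distrib_right[symmetric])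
  also have "(\<Sum>x\<in>X. pmf ?g x * (if x \<in> K then phiS d K {x} else 0)) = (\<Sum>x\<in>K. pmf ?g x * phiS d K {x})"
    using X KX by (simp add: if_distrib[of "\<lambda>y. _ * y"] sum.If_cases Int_absorb1 cong: if_cong)
  also have "\<dots> \<le> (\<Sum>x\<in>K. real l / real (card X) * phiS d K {x})"
    using w KX by (intro sum_mono mult_right_mono phiS_nonneg) auto
  also have "\<dots> = real l / real (card X) * (\<Sum>x\<in>K. \<Sum>y\<in>K. sqdist d y x)"
    by (simp add: sum_distrib_left phiS_def phi_def)
  also have "\<dots> \<le> real l / real (card X) * (4 * real (card K) * Opt)"
    unfolding Opt_def by (intro mult_left_mono sum_sqdist_pairs_le finK) auto
  also have "\<dots> = 4 * real l * Opt * (real (card K) / real (card X))" by simp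
  also have "\<dots> \<le> 4 * real l * Opt * 1"
    using card_mono[OF X KX] Opt_nonneg by (intro mult_left_mono) (auto simp: divide_le_eq_1)
  finally show ?thesis by (simp add: T_def)
qed

lemma expectation_V_le:
  assumes "X \<noteq> {}" "i \<le> k"
  shows "measure_pmf.expectation (greedy_kmeanspp d X l i) V \<le> 2 * 10^9 * (real l)\<^sup>2 * (ln (real k))\<^sup>2 * Opt"
proof -
  let ?L = "ln (real k)"
  let ?V0 = "4 * real l * Opt + (tau * Opt + G * (400 * real l * M\<^sup>2 + 4 * M + 15))"
  have "measure_pmf.expectation (greedy_kmeanspp d X l i) V \<le> ?V0 + real i * (8 * G / real k)"
  proof (induction i)
    case 0 then show ?case using V_first[OF assms(1)] by simp
  next
    case (Suc i)
    have "measure_pmf.expectation (greedy_kmeanspp d X l (Suc i)) V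
        \<le> measure_pmf.expectation (greedy_kmeanspp d X l i) (\<lambda>C. V C + 8 * G / real k)"
      using V_step[OF assms(1)] by (intro expectation_greedy_Suc_le X assms(1) l)
    also have "\<dots> = measure_pmf.expectation (greedy_kmeanspp d X l i) V + 8 * G / real k"
      by (subst Bochner_Integration.integral_add)
         (auto intro!: integrable_measure_pmf_finite finite_set_greedy_kmeanspp X assms(1) l)
    also have "\<dots> \<le> ?V0 + real i * (8 * G / real k) + 8 * G / real k" using Suc by simp
    finally show ?case by (simp add: algebra_simps add_divide_distrib)
  qed
  also have "\<dots> \<le> ?V0 + real k * (8 * G / real k)"
    using assms(2) G_nonneg by (intro add_left_mono mult_right_mono) auto
  also have "real k * (8 * G / real k) = 8 * G" using k by simp
  also have "?V0 + 8 * G \<le> 2 * 10^9 * (real l)\<^sup>2 * ?L\<^sup>2 * Opt"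
  proof -
    have L: "2/3 \<le> ?L" using ln_ge_two_thirds[OF k] .
    have "2/3 * ?L \<le> ?L\<^sup>2" unfolding power2_eq_square using L by (intro mult_right_mono) auto
    then have L2: "?L \<le> 3/2 * ?L\<^sup>2" "1 \<le> 9/4 * ?L\<^sup>2" using L by linarith+
    have l1: "1 \<le> real l" using l by simp
    define a where "a = real l * ?L\<^sup>2"
    define b where "b = (real l)\<^sup>2 * ?L\<^sup>2"
    have a: "?L\<^sup>2 \<le> a" unfolding a_def using mult_right_mono[OF l1, of "?L\<^sup>2"] by simp
    have ba: "b = real l * a" by (simp add: a_def b_def power2_eq_square)
    have ab: "a \<le> b" unfolding ba using mult_right_mono[OF l1, of a] a by (simp add: a_def)
    have l2: "real l \<le> 9/4 * a" using mult_left_mono[OF L2(2), of "real l"] by (simp add: a_def)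
    have t: "4 * real l + tau \<le> 400000 * b"
    proof -
      have "tau = 100000 + 100000 * ?L" by (simp add: tau_def)
      then show ?thesis using l2 L2 a ab by linarith
    qed
    \<comment> \<open>\<open>400 * 15^2 = 90000\<close>; the other 1000 absorbs lower-order terms,
      using \<open>ln k \<ge> 2/3\<close>.\<close>
    have p: "400 * real l * M\<^sup>2 + 4 * M + 15 + 8 \<le> 91000 * a"
    proof -
      have "400 * real l * M\<^sup>2 = 90000 * a" by (simp add: M_def a_def power_mult_distrib)
      moreover have "4 * M = 60 * ?L" by (simp add: M_def)
      ultimately show ?thesis using L2 a by linarith
    qed
    have b0: "0 \<le> b * Opt" using Opt_nonneg by (simp add: b_def)
    have "?V0 + 8 * G = (4 * real l + tau) * Opt + G * (400 * real l * M\<^sup>2 + 4 * M + 15 + 8)"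
      by (simp add: algebra_simps)
    also have "\<dots> \<le> 400000 * b * Opt + G * (91000 * a)"
      using t p Opt_nonneg G_nonneg by (intro add_mono mult_right_mono mult_left_mono) auto
    also have "G * (91000 * a) = 1419600000 * b * Opt"
      by (simp add: G_def ba)
    also have "400000 * b * Opt + 1419600000 * b * Opt \<le> 2 * 10^9 * (b * Opt)"
      using b0 by simp
    also have "\<dots> = 2 * 10^9 * (real l)\<^sup>2 * ?L\<^sup>2 * Opt" unfolding b_def by (simp only: mult.assoc)
    finally show ?thesis .
  qed
  finally show ?thesis .
qed

lemma solved_cost_le_V:
  assumes "finite C" "C \<noteq> {}"
  shows "(if solved C then phiS d K C else 0) \<le> V C"
proof (cases "solved C")
  case False
  then show ?thesis using Psi_ge[OF assms False] G_nonneg tau_ge Opt_nonneg by (simp add: V_def)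
qed (simp add: V_def)

end

section \<open>All clusters\<close>

text \<open>With \<open>u\<close> unsolved clusters of equal cost and \<open>n\<close> remaining steps, the fraction of the cost that
  survives if each step solves one of them.\<close>
definition excess :: "nat \<Rightarrow> nat \<Rightarrow> real" where
  "excess n u = (if u \<le> n then 0 else 1 - real n / real u)"

lemma excess_bounds: "0 \<le> excess n u" "excess n u \<le> 1"
  by (auto simp: excess_def divide_le_eq_1)

lemma excess_mono: "u \<le> v \<Longrightarrow> excess n u \<le> excess n v"
  by (auto simp: excess_def divide_le_eq_1 intro!: divide_left_mono)

text \<open>For \<open>v = u - 1 > n\<close> the left side is
  \<open>(v - n) / (v + 1) * (1 + e / v)\<close>, whose first factor is
  \<open>excess (Suc n) u\<close>. Here \<open>e\<close> is the fraction of its cost that a newly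
  solved cluster keeps.\<close>

lemma excess_step:
  assumes "0 \<le> e" "u \<ge> 1"
  shows "excess n (u - 1) * (1 - (1 - e) / real u) \<le> (1 + e / real (Suc n)) * excess (Suc n) u"
proof (cases "u \<le> Suc n")
  case True then have "u - 1 \<le> n" by simp
  then show ?thesis using True by (simp add: excess_def)
next
  case False
  then obtain v where v: "u = Suc v" "n + 1 \<le> v" by (cases u) auto
  then have v0: "0 < real v" "real n + 1 \<le> real v" by auto
  have "excess n (u - 1) * (1 - (1 - e) / real u) = (real v - real n) / (real v + 1) * (1 + e / real v)"
    using v v0 by (simp add: excess_def field_simps)
  also have "\<dots> \<le> (real v - real n) / (real v + 1) * (1 + e / real (Suc n))"
    using v0 assms by (intro mult_left_mono add_left_mono divide_left_mono) auto
  also have "(real v - real n) / (real v + 1) = excess (Suc n) u"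
    using v v0 by (simp add: excess_def field_simps)
  finally show ?thesis by (simp add: mult.commute)
qed

text \<open>The price of a wasted step; over the run these prices form a harmonic sum.\<close>

lemma excess_diff_le:
  assumes "u \<ge> 1" shows "excess n u \<le> excess n (u - 1) + 1 / real (Suc n)"
proof -
  obtain v where v: "u = Suc v" using assms by (cases u) auto
  consider "v < n" | "v = n" | "v > n" by linarith
  then show ?thesis
  proof cases
    case 1 then show ?thesis by (simp add: excess_def v)
  next
    case 2 then show ?thesis by (simp add: excess_def v field_simps)
  next
    case 3
    have "real n / real v - real n / real (Suc v) = real n / (real v * real (Suc v))"
      using 3 by (simp add: field_simps)
    also have "\<dots> \<le> real v / (real v * real (Suc v))" using 3 by (intro divide_right_mono) auto
    also have "\<dots> \<le> 1 / real (Suc n)" using 3 by (simp add: divide_simps)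
    finally show ?thesis using 3 by (simp add: excess_def v)
  qed
qed

lemma excess_div_le: "excess n (u - 1) / real u \<le> 1 / real (Suc n)"
proof (cases "u \<le> Suc n")
  case True then have "u - 1 \<le> n" by simp
  then show ?thesis by (simp add: excess_def)
next
  case False
  have "excess n (u - 1) / real u \<le> 1 / real u" using excess_bounds by (intro divide_right_mono) auto
  also have "\<dots> \<le> 1 / real (Suc n)" using False by (intro divide_left_mono) auto
  finally show ?thesis .
qed

lemma sum_inverse_le_ln: "(\<Sum>j<Suc n. 1 / real (Suc j)) \<le> 1 + ln (real (Suc n))"
proof (induction n)
  case (Suc n)
  have "ln (real (Suc n) / real (Suc (Suc n))) \<le> real (Suc n) / real (Suc (Suc n)) - 1"
    by (intro ln_le_minus_one) auto
  also have "\<dots> = - 1 / real (Suc (Suc n))" by (simp add: field_simps)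
  finally have "1 / real (Suc (Suc n)) \<le> ln (real (Suc (Suc n))) - ln (real (Suc n))"
    by (simp add: ln_div)
  with Suc show ?case by simp
qed simp

section \<open>Comparison with an arbitrary set of k centres\<close>

locale clustering =
  fixes d :: nat and X A :: "(nat \<Rightarrow> real) set" and k l :: nat and asg :: "(nat \<Rightarrow> real) \<Rightarrow> nat \<Rightarrow> real"
  assumes X: "finite X" "X \<noteq> {}" and A: "finite A" "card A = k" and k: "k \<ge> 2" and l: "l \<ge> 1"
    and asg: "\<And>x. x \<in> X \<Longrightarrow> asg x \<in> A" "\<And>x. x \<in> X \<Longrightarrow> sqdist d x (asg x) = phi d x A"
begin

definition "cell a = {x \<in> X. asg x = a}"

sublocale cl: cluster d X "cell a" a k l for a
  using X k l by unfold_locales (auto simp: cell_def)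

definition "unsolved C = {a \<in> A. \<not> cl.solved a C}"
definition "H C = (\<Sum>a\<in>A - unsolved C. phiS d (cell a) C)"
definition "u C = card (unsolved C)"
text \<open>The reciprocal of the bound on the harmonic sum, so that the factors
  \<open>1 + eps / n\<close> of all steps multiply to at most \<open>exp 1\<close>.\<close>

definition "eps = 1 / (1 + ln (real k))"

lemma fin_unsolved [simp]: "finite (unsolved C)" using A by (simp add: unsolved_def)

lemma sum_cells: "(\<Sum>a\<in>A. \<Sum>x\<in>cell a. f x) = (\<Sum>x\<in>X. f x)" for f :: "_ \<Rightarrow> real"
  unfolding cell_def using asg(1) by (intro sum.group X A) auto

lemma phiS_cells: "phiS d X C = (\<Sum>a\<in>A. phiS d (cell a) C)"
  unfolding phiS_def sum_cells ..

lemma sum_Opt: "(\<Sum>a\<in>A. cl.Opt a) = phiS d X A"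
proof -
  have "(\<Sum>a\<in>A. cl.Opt a) = (\<Sum>a\<in>A. \<Sum>x\<in>cell a. phi d x A)"
    unfolding cl.Opt_def using asg(2) by (intro sum.cong) (auto simp: cell_def)
  then show ?thesis by (simp add: sum_cells phiS_def)
qed

lemma eps_bounds: "0 < eps" "eps \<le> 1"
  using cl.ln_k_pos by (auto simp: eps_def)

lemma H_nonneg: "finite C \<Longrightarrow> C \<noteq> {} \<Longrightarrow> 0 \<le> H C"
  by (simp add: H_def sum_nonneg phiS_nonneg)

lemma unsolved_insert:
  assumes "finite C" "C \<noteq> {}" shows "unsolved (insert x C) \<subseteq> unsolved C"
  using cl.V_insert_solved(2)[OF assms] by (auto simp: unsolved_def)

lemma u_insert_le: "finite C \<Longrightarrow> C \<noteq> {} \<Longrightarrow> u (insert x C) \<le> u C"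
  unfolding u_def by (intro card_mono unsolved_insert) auto

lemma hit_not_unsolved:
  assumes "x \<in> C" "x \<in> X" shows "asg x \<notin> unsolved C"
proof -
  have "x \<in> C \<inter> cell (asg x)" using assms by (simp add: cell_def)
  then have "cl.solved (asg x) C" unfolding cl.solved_def by blast
  then show ?thesis by (simp add: unsolved_def)
qed

lemma u_insert_less:
  assumes "finite C" "C \<noteq> {}" "x \<in> X" "asg x \<in> unsolved C"
  shows "u (insert x C) \<le> u C - 1"
proof -
  have "asg x \<notin> unsolved (insert x C)" using assms(3) by (intro hit_not_unsolved insertI1)
  then have "unsolved (insert x C) \<subseteq> unsolved C - {asg x}" using unsolved_insert[OF assms(1,2)] by auto
  then have "u (insert x C) \<le> card (unsolved C - {asg x})" unfolding u_def by (intro card_mono) auto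
  then show ?thesis using assms(4) by (simp add: u_def)
qed

text \<open>A D^2 sample hits an unsolved cell of cost \<open>P\<close> with probability
  \<open>P / F\<close>, where \<open>F\<close> is the total cost, and then removes at least
  \<open>(1 - eps) * P\<close> in expectation. By Cauchy-Schwarz the squares \<open>P^2\<close> sum
  to at least \<open>(F - H)^2 / u \<ge> F * (F - 2 * H) / u\<close>. The greedy choice does at
  least as well in expectation.\<close>

lemma expected_cost_step:
  assumes C: "finite C" "C \<noteq> {}" and F: "phiS d X C > 0" and u: "u C \<ge> 1"
    and w: "greedy_weights d X l C w"
  shows "(\<Sum>x\<in>X. w x * phiS d X (insert x C))
      \<le> phiS d X C * (1 - (1 - eps) / real (u C)) + 2 * H C / real (u C)"
proof -
  let ?F = "phiS d X C"
  let ?U = "\<Sum>a\<in>unsolved C. phiS d (cell a) C"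
  let ?S = "\<Sum>a\<in>unsolved C. (phiS d (cell a) C)\<^sup>2"
  have UA: "unsolved C \<subseteq> A" by (auto simp: unsolved_def)
  have gain: "(\<Sum>x\<in>cell a. phi d x C * (?F - phiS d X (insert x C))) \<ge> (1 - eps) * (phiS d (cell a) C)\<^sup>2"
    if a: "a \<in> unsolved C" for a
  proof -
    let ?P = "phiS d (cell a) C"
    have aA: "a \<in> A" and ns: "\<not> cl.solved a C" using a by (auto simp: unsolved_def)
    have "(\<Sum>x\<in>cell a. phi d x C * (?P - phiS d (cell a) (insert x C)))
        \<le> (\<Sum>x\<in>cell a. phi d x C * (?F - phiS d X (insert x C)))"
    proof (intro sum_mono mult_left_mono phi_nonneg C)
      fix x
      have "?F - phiS d X (insert x C) = (\<Sum>b\<in>A. phiS d (cell b) C - phiS d (cell b) (insert x C))"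
        by (simp add: phiS_cells sum_subtractf)
      moreover have "?P - phiS d (cell a) (insert x C) \<le> \<dots>"
        using aA A C by (intro member_le_sum) (auto simp: phiS_insert_le)
      ultimately show "?P - phiS d (cell a) (insert x C) \<le> ?F - phiS d X (insert x C)" by simp
    qed
    moreover have "(\<Sum>x\<in>cell a. phi d x C * (?P - phiS d (cell a) (insert x C)))
        = ?P\<^sup>2 - (\<Sum>x\<in>cell a. phi d x C * phiS d (cell a) (insert x C))"
      by (simp add: right_diff_distrib sum_subtractf sum_distrib_right[symmetric] power2_eq_square phiS_def[symmetric])
    moreover have "(\<Sum>x\<in>cell a. phi d x C * phiS d (cell a) (insert x C)) \<le> eps * ?P\<^sup>2"
    proof -
      have P0: "0 < ?P" using cl.cost_K(2)[OF C ns] .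
      have "(\<Sum>x\<in>cell a. phi d x C * phiS d (cell a) (insert x C)) \<le> 26 * ?P * cl.Opt a"
        by (rule D2_weighted_cost_le[OF cl.finK C cl.Opt_def cl.cost_K(3)[OF C ns]])
      also have "26 * ?P * cl.Opt a \<le> ?P * (eps * ?P)"
      proof -
        have t: "cl.tau = 10^5 / eps" using cl.ln_k_pos by (simp add: cl.tau_def eps_def)
        have "cl.tau * cl.Opt a < ?P" using ns by (auto simp: cl.solved_def)
        then have "10^5 * cl.Opt a < eps * ?P" using eps_bounds by (simp add: t field_simps)
        then have "26 * cl.Opt a \<le> eps * ?P" using cl.Opt_nonneg[of a] by simp
        then show ?thesis using mult_left_mono[of "26 * cl.Opt a" "eps * ?P" ?P] P0 by (simp add: mult_ac)
      qed
      finally show ?thesis by (simp add: power2_eq_square mult_ac)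
    qed
    ultimately show ?thesis by (simp add: left_diff_distrib)
  qed
  have nn: "0 \<le> phi d x C * (?F - phiS d X (insert x C))" for x
    using phiS_insert_le[OF C, of d X x] phi_nonneg[OF C] by simp
  have "(1 - eps) * ?S \<le> (\<Sum>a\<in>unsolved C. \<Sum>x\<in>cell a. phi d x C * (?F - phiS d X (insert x C)))"
    unfolding sum_distrib_left using gain by (intro sum_mono) auto
  also have "\<dots> \<le> (\<Sum>a\<in>A. \<Sum>x\<in>cell a. phi d x C * (?F - phiS d X (insert x C)))"
    using A UA nn by (intro sum_mono2 sum_nonneg) auto
  also have "\<dots> = ?F * ?F - (\<Sum>x\<in>X. phi d x C * phiS d X (insert x C))"
    unfolding sum_cells by (simp add: right_diff_distrib sum_subtractf sum_distrib_right[symmetric] phiS_def[symmetric])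
  finally have 1: "(\<Sum>x\<in>X. phi d x C * phiS d X (insert x C)) \<le> ?F * ?F - (1 - eps) * ?S" by simp
  have FU: "?F = ?U + H C"
    unfolding phiS_cells H_def using A UA by (subst add.commute) (rule sum.subset_diff, auto)
  have H0: "0 \<le> H C" using H_nonneg[OF C] .
  have "?U\<^sup>2 \<le> ?S * real (u C)" unfolding u_def by (rule sum_squared_le_sum_of_squares)
  moreover have "?F * (?F - 2 * H C) \<le> ?U\<^sup>2"
    unfolding FU by (simp add: power2_eq_square algebra_simps)
  ultimately have "?F * (?F - 2 * H C) / real (u C) \<le> ?S" using u by (simp add: divide_simps)
  then have 2: "(1 - eps) * (?F * (?F - 2 * H C) / real (u C)) \<le> (1 - eps) * ?S"
    using eps_bounds by (intro mult_left_mono) auto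
  have "(\<Sum>x\<in>X. w x * phiS d X (insert x C)) \<le> (\<Sum>x\<in>X. phi d x C / ?F * phiS d X (insert x C))"
    using w by (simp add: greedy_weights_def)
  also have "\<dots> = (\<Sum>x\<in>X. phi d x C * phiS d X (insert x C)) / ?F"
    by (simp add: sum_divide_distrib)
  also have "\<dots> \<le> (?F * ?F - (1 - eps) * (?F * (?F - 2 * H C) / real (u C))) / ?F"
    using 1 2 F by (intro divide_right_mono) auto
  also have "\<dots> = ?F - (1 - eps) * (?F - 2 * H C) / real (u C)"
    using F by (simp add: diff_divide_distrib)
  also have "\<dots> = ?F * (1 - (1 - eps) / real (u C)) + (1 - eps) * (2 * H C / real (u C))"
    by (simp add: algebra_simps diff_divide_distrib add_divide_distrib)
  also have "\<dots> \<le> ?F * (1 - (1 - eps) / real (u C)) + 1 * (2 * H C / real (u C))"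
    using eps_bounds H0 by (intro add_left_mono mult_right_mono) auto
  finally show ?thesis by simp
qed

lemma wasted_weight_le:
  assumes C: "finite C" "C \<noteq> {}" and F: "phiS d X C > 0" and w: "greedy_weights d X l C w"
  shows "(\<Sum>x | x \<in> X \<and> asg x \<notin> unsolved C. w x) * phiS d X C \<le> real l * H C"
proof -
  let ?F = "phiS d X C" let ?Y = "{x \<in> X. asg x \<notin> unsolved C}"
  have "(\<Sum>x\<in>?Y. w x) * ?F \<le> (\<Sum>x\<in>?Y. real l * (phi d x C / ?F)) * ?F"
    using w F by (intro mult_right_mono sum_mono) (auto simp: greedy_weights_def)
  also have "\<dots> = real l * (\<Sum>x\<in>?Y. phi d x C)"
    using F by (simp add: sum_distrib_left sum_distrib_right)
  also have "(\<Sum>x\<in>?Y. phi d x C) = (\<Sum>a\<in>A - unsolved C. \<Sum>x | x \<in> ?Y \<and> asg x = a. phi d x C)"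
    using X A asg(1) by (intro sum.group[symmetric]) auto
  also have "\<dots> = H C" unfolding H_def phiS_def by (intro sum.cong) (auto simp: cell_def)
  finally show ?thesis .
qed

text \<open>In \<open>l + 2\<close>, the \<open>l\<close> comes from wasted steps and the 2 from the
  error \<open>2 * H C / u C\<close> in the expected cost. A point of an unsolved cluster lowers
  \<open>u C\<close>; any other choice costs at most an extra \<open>1 / (n + 1)\<close> of the
  total cost.\<close>

lemma excess_cost_step:
  assumes C: "finite C" "C \<noteq> {}"
  shows "measure_pmf.expectation (greedy_step d X l C) (\<lambda>C. excess n (u C) * phiS d X C)
     \<le> (1 + eps / real (Suc n)) * (excess (Suc n) (u C) * phiS d X C) + real (l + 2) * H C / real (Suc n)"
proof -
  let ?F = "phiS d X C"
  note W = greedy_step_sum[OF X C l, of d]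
  define w where "w = pmf (greedy_choice (\<lambda>c. phiS d X (insert c C)) l (D2_pmf d X C))"
  note W = W[folded w_def]
  have H0: "0 \<le> H C" using H_nonneg[OF C] .
  show ?thesis
  proof (cases "u C = 0")
    case True
    then have "u (insert x C) = 0" for x using u_insert_le[OF C, of x] by simp
    then show ?thesis using H0 by (simp add: W(1) excess_def True)
  next
    case False
    then have u1: "u C \<ge> 1" by simp
    then have "unsolved C \<noteq> {}" by (auto simp: u_def)
    then obtain a where "\<not> cl.solved a C" by (auto simp: unsolved_def)
    then have F: "?F > 0" using cl.cost_pos[OF C] by blast
    note gw = W(4)[OF F]
    let ?e = "excess n (u C - 1)"
    have e0: "0 \<le> ?e" by (rule excess_bounds)
    have pt: "w x * (excess n (u (insert x C)) * phiS d X (insert x C))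
       \<le> ?e * (w x * phiS d X (insert x C)) + (if asg x \<notin> unsolved C then w x * (?F / real (Suc n)) else 0)"
      if x: "x \<in> X" for x
    proof -
      have F'0: "0 \<le> phiS d X (insert x C)" using C by (simp add: phiS_nonneg)
      have "excess n (u (insert x C)) * phiS d X (insert x C)
         \<le> ?e * phiS d X (insert x C) + (if asg x \<notin> unsolved C then ?F / real (Suc n) else 0)"
      proof (cases "asg x \<in> unsolved C")
        case True
        then show ?thesis
          using mult_right_mono[OF excess_mono[OF u_insert_less[OF C x True], of n] F'0] by simp
      next
        case False
        have "excess n (u (insert x C)) \<le> ?e + 1 / real (Suc n)"
          using excess_mono[OF u_insert_le[OF C, of x], of n] excess_diff_le[OF u1, of n] by linarith
        then have "excess n (u (insert x C)) * phiS d X (insert x C) \<le> (?e + 1 / real (Suc n)) * phiS d X (insert x C)"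
          using F'0 by (rule mult_right_mono)
        also have "\<dots> = ?e * phiS d X (insert x C) + phiS d X (insert x C) / real (Suc n)"
          by (simp add: distrib_right)
        also have "\<dots> \<le> ?e * phiS d X (insert x C) + ?F / real (Suc n)"
          using phiS_insert_le[OF C] by (intro add_left_mono divide_right_mono) auto
        finally show ?thesis using False by simp
      qed
      from mult_left_mono[OF this W(2)[of x]] show ?thesis by (auto simp: distrib_left mult_ac)
    qed
    have "measure_pmf.expectation (greedy_step d X l C) (\<lambda>C. excess n (u C) * phiS d X C)
      \<le> (\<Sum>x\<in>X. ?e * (w x * phiS d X (insert x C)) + (if asg x \<notin> unsolved C then w x * (?F / real (Suc n)) else 0))"
      unfolding W(1) by (intro sum_mono pt)
    also have "\<dots> = ?e * (\<Sum>x\<in>X. w x * phiS d X (insert x C))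
        + (\<Sum>x | x \<in> X \<and> asg x \<notin> unsolved C. w x) * ?F / real (Suc n)"
      using X by (simp add: sum.distrib sum_distrib_left[symmetric] sum_distrib_right[symmetric]
          sum.If_cases Int_def sum_divide_distrib[symmetric])
    also have "\<dots> \<le> ?e * (?F * (1 - (1 - eps) / real (u C)) + 2 * H C / real (u C)) + real l * H C / real (Suc n)"
      using expected_cost_step[OF C F u1 gw] wasted_weight_le[OF C F gw] e0
      by (intro add_mono mult_left_mono divide_right_mono) auto
    also have "\<dots> = (?e * (1 - (1 - eps) / real (u C))) * ?F + ?e / real (u C) * (2 * H C) + real l * H C / real (Suc n)"
      by (simp add: algebra_simps)
    also have "\<dots> \<le> ((1 + eps / real (Suc n)) * excess (Suc n) (u C)) * ?F + 1 / real (Suc n) * (2 * H C) + real l * H C / real (Suc n)"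
      using excess_step[of eps "u C" n] excess_div_le[of n "u C"] eps_bounds u1 F H0
      by (intro add_mono mult_right_mono) auto
    also have "\<dots> = (1 + eps / real (Suc n)) * (excess (Suc n) (u C) * ?F) + real (l + 2) * H C / real (Suc n)"
      by (simp add: algebra_simps add_divide_distrib)
    finally show ?thesis .
  qed
qed

lemma expectation_H_le:
  assumes "i \<le> k"
  shows "measure_pmf.expectation (greedy_kmeanspp d X l i) H
     \<le> 2 * 10^9 * (real l)\<^sup>2 * (ln (real k))\<^sup>2 * phiS d X A"
proof -
  have "measure_pmf.expectation (greedy_kmeanspp d X l i) H
     \<le> measure_pmf.expectation (greedy_kmeanspp d X l i) (\<lambda>C. \<Sum>a\<in>A. cl.V a C)"
  proof (intro expectation_greedy_mono X l)
    fix C :: "(nat \<Rightarrow> real) set" assume C: "finite C" "C \<noteq> {}"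
    have "H C = (\<Sum>a\<in>A. if cl.solved a C then phiS d (cell a) C else 0)"
      unfolding H_def using A by (simp add: sum.If_cases unsolved_def Int_def set_diff_eq) (rule sum.cong, auto)
    also have "\<dots> \<le> (\<Sum>a\<in>A. cl.V a C)" by (intro sum_mono cl.solved_cost_le_V C)
    finally show "H C \<le> (\<Sum>a\<in>A. cl.V a C)" .
  qed
  also have "\<dots> = (\<Sum>a\<in>A. measure_pmf.expectation (greedy_kmeanspp d X l i) (cl.V a))"
    by (intro Bochner_Integration.integral_sum integrable_measure_pmf_finite finite_set_greedy_kmeanspp X l)
  also have "\<dots> \<le> (\<Sum>a\<in>A. 2 * 10^9 * (real l)\<^sup>2 * (ln (real k))\<^sup>2 * cl.Opt a)"
    by (intro sum_mono cl.expectation_V_le X assms)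
  also have "\<dots> = 2 * 10^9 * (real l)\<^sup>2 * (ln (real k))\<^sup>2 * phiS d X A"
    by (simp only: sum_distrib_left[symmetric] sum_Opt)
  finally show ?thesis .
qed

text \<open>After the first centre at most \<open>k - 1\<close> clusters are unsolved, as many as
  steps remain, so the excess starts at 0.\<close>

lemma u_le:
  assumes "C \<subseteq> X" "C \<noteq> {}" shows "u C \<le> k - 1"
proof -
  obtain x where x: "x \<in> C" "x \<in> X" using assms by auto
  have "unsolved C \<subseteq> A" by (auto simp: unsolved_def)
  then have "unsolved C \<subseteq> A - {asg x}" using hit_not_unsolved[OF x] by blast
  then have "u C \<le> card (A - {asg x})" unfolding u_def using A by (intro card_mono) auto
  then show ?thesis using A asg(1)[OF x(2)] by simp
qed

text \<open>With \<open>m\<close> steps left, a step multiplies the bound by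
  \<open>1 + eps / m \<le> exp (eps / m)\<close> and adds at most \<open>h / m\<close>;
  \<open>S i\<close> collects these reciprocals.\<close>

lemma expectation_excess_le:
  assumes "i \<le> k - 1"
  defines "S \<equiv> \<lambda>i. \<Sum>j<i. 1 / real (k - 1 - j)"
  defines "h \<equiv> real (l + 2) * (2 * 10^9 * (real l)\<^sup>2 * (ln (real k))\<^sup>2 * phiS d X A)"
  shows "measure_pmf.expectation (greedy_kmeanspp d X l i) (\<lambda>C. excess (k - 1 - i) (u C) * phiS d X C)
     \<le> exp (eps * S i) * h * S i"
  using assms(1)
proof (induction i)
  case 0
  have "measure_pmf.expectation (greedy_kmeanspp d X l 0) (\<lambda>C. excess (k - 1 - 0) (u C) * phiS d X C)
     \<le> measure_pmf.expectation (greedy_kmeanspp d X l 0) (\<lambda>C. 0)"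
    using u_le by (intro expectation_greedy_mono X l) (simp add: excess_def)
  then show ?case by (simp add: S_def)
next
  case (Suc i)
  define n where "n = k - 1 - Suc i"
  have n: "k - 1 - i = Suc n" using Suc.prems by (simp add: n_def)
  let ?q = "\<lambda>C. excess (Suc n) (u C) * phiS d X C"
  let ?E = "measure_pmf.expectation (greedy_kmeanspp d X l i)"
  let ?r = "1 / real (Suc n)"
  have A0: "0 \<le> phiS d X A" using A k by (intro phiS_nonneg) auto
  have h0: "0 \<le> h" using A0 by (simp add: h_def)
  have S0: "0 \<le> S i" unfolding S_def by (rule sum_nonneg) simp
  have S1: "S (Suc i) = S i + ?r" unfolding S_def sum.lessThan_Suc n ..
  have fin: "integrable (measure_pmf (greedy_kmeanspp d X l i)) f" for f :: "_ \<Rightarrow> real"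
    by (intro integrable_measure_pmf_finite finite_set_greedy_kmeanspp X l)
  have "measure_pmf.expectation (greedy_kmeanspp d X l (Suc i)) (\<lambda>C. excess n (u C) * phiS d X C)
     \<le> ?E (\<lambda>C. (1 + eps / real (Suc n)) * ?q C + real (l + 2) * H C / real (Suc n))"
    by (intro expectation_greedy_Suc_le X l excess_cost_step)
  also have "\<dots> = (1 + eps * ?r) * ?E ?q + real (l + 2) * ?E H * ?r"
    by (subst Bochner_Integration.integral_add[OF fin fin]) simp
  also have "\<dots> \<le> (1 + eps * ?r) * (exp (eps * S i) * h * S i) + h * ?r"
  proof (intro add_mono mult_left_mono mult_right_mono)
    have "i \<le> k - 1" using Suc.prems by simp
    from Suc.IH[OF this] show "?E ?q \<le> exp (eps * S i) * h * S i" unfolding n .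
    show "real (l + 2) * ?E H \<le> h"
      unfolding h_def using Suc.prems k by (intro mult_left_mono expectation_H_le) auto
  qed (use eps_bounds in auto)
  also have "\<dots> \<le> exp (eps * ?r) * (exp (eps * S i) * h * S i) + exp (eps * S (Suc i)) * h * ?r"
  proof (intro add_mono mult_right_mono)
    show "1 + eps * ?r \<le> exp (eps * ?r)" by (rule exp_ge_add_one_self)
    have "1 \<le> exp (eps * S (Suc i))" using S0 S1 eps_bounds by simp
    then show "h \<le> exp (eps * S (Suc i)) * h" using h0 mult_right_mono[of 1 _ h] by simp
  qed (use h0 S0 in auto)
  also have "exp (eps * ?r) * (exp (eps * S i) * h * S i) = exp (eps * S (Suc i)) * h * S i"
    by (simp only: S1 distrib_left exp_add mult_ac)
  also have "exp (eps * S (Suc i)) * h * S i + exp (eps * S (Suc i)) * h * ?r = exp (eps * S (Suc i)) * h * S (Suc i)"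
    by (simp only: S1 distrib_left)
  finally show ?case by (simp only: n_def)
qed

text \<open>With no step left, \<open>excess 0 u\<close> is 1 unless all clusters are solved, so the
  total cost is at most the excess term plus \<open>H\<close>.\<close>

lemma greedy_cost_le:
  "measure_pmf.expectation (greedy_kmeanspp d X l (k - 1)) (phiS d X)
     \<le> 48 * 10^9 * real l ^ 3 * ln (real k) ^ 3 * phiS d X A"
proof -
  let ?L = "ln (real k)"
  define h where "h = 2 * 10^9 * (real l)\<^sup>2 * ?L\<^sup>2 * phiS d X A"
  define S where "S = (\<Sum>j<k - 1. 1 / real (k - 1 - j))"
  let ?E = "measure_pmf.expectation (greedy_kmeanspp d X l (k - 1))"
  have A0: "0 \<le> phiS d X A" using A k by (intro phiS_nonneg) auto
  have h0: "0 \<le> h" using A0 by (simp add: h_def)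
  have fin: "integrable (measure_pmf (greedy_kmeanspp d X l (k - 1))) f" for f :: "_ \<Rightarrow> real"
    by (intro integrable_measure_pmf_finite finite_set_greedy_kmeanspp X l)
  have S: "0 \<le> S" "S \<le> 1 + ?L"
  proof -
    show "0 \<le> S" unfolding S_def by (rule sum_nonneg) simp
    obtain m where m: "k = Suc (Suc m)" using k by (intro that[of "k - 2"]) simp
    have "S = (\<Sum>j<Suc m. 1 / real (Suc m - j))" by (simp add: S_def m del: sum.lessThan_Suc)
    also have "\<dots> = (\<Sum>j<Suc m. 1 / real (Suc j))"
      by (subst sum.nat_diff_reindex[symmetric], intro sum.cong) (auto simp: Suc_diff_Suc of_nat_diff)
    also have "\<dots> \<le> 1 + ln (real (Suc m))" by (rule sum_inverse_le_ln)
    also have "\<dots> \<le> 1 + ?L" by (simp add: m)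
    finally show "S \<le> 1 + ?L" .
  qed
  have "eps * S \<le> eps * (1 + ?L)" using S eps_bounds by (intro mult_left_mono) auto
  also have "\<dots> = 1" using cl.ln_k_pos by (simp add: eps_def)
  finally have "exp (eps * S) \<le> exp 1" by simp
  then have e: "exp (eps * S) \<le> 3" using exp_le by linarith
  have "?E (phiS d X) \<le> ?E (\<lambda>C. excess 0 (u C) * phiS d X C + H C)"
  proof (intro expectation_greedy_mono X l)
    fix C :: "(nat \<Rightarrow> real) set" assume C: "finite C" "C \<noteq> {}"
    show "phiS d X C \<le> excess 0 (u C) * phiS d X C + H C"
    proof (cases "u C = 0")
      case True
      then have "unsolved C = {}" by (simp add: u_def)
      then show ?thesis by (simp add: excess_def True H_def phiS_cells)
    next
      case False then show ?thesis using H_nonneg[OF C] by (simp add: excess_def)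
    qed
  qed
  also have "\<dots> = ?E (\<lambda>C. excess 0 (u C) * phiS d X C) + ?E H"
    by (rule Bochner_Integration.integral_add[OF fin fin])
  also have "\<dots> \<le> exp (eps * S) * (real (l + 2) * h) * S + h"
  proof (rule add_mono)
    show "?E (\<lambda>C. excess 0 (u C) * phiS d X C) \<le> exp (eps * S) * (real (l + 2) * h) * S"
      using expectation_excess_le[OF order_refl] unfolding diff_self_eq_0 S_def h_def .
    show "?E H \<le> h" unfolding h_def by (rule expectation_H_le) simp
  qed
  \<comment> \<open>The bounds are \<open>exp 1 \<le> 3\<close> and
    \<open>1 + ln k \<le> 5/2 * ln k\<close>; altogether
    \<open>3 * 3 * 5/2 + 3/2 = 24\<close>.\<close>
  also have "\<dots> \<le> 3 * (real (3 * l) * h) * (5/2 * ?L) + (3/2 * real l * ?L) * h"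
  proof (intro add_mono mult_mono)
    have L: "2/3 \<le> ?L" using ln_ge_two_thirds[OF k] .
    then show "S \<le> 5/2 * ?L" using S by linarith
    have "1 * (2/3) \<le> real l * ?L" using L l by (intro mult_mono) auto
    then have "1 * h \<le> (3/2 * real l * ?L) * h" using h0 by (intro mult_right_mono) auto
    then show "h \<le> (3/2 * real l * ?L) * h" by simp
    show "real (l + 2) \<le> real (3 * l)" using l by simp
  qed (use e h0 S in auto)
  also have "\<dots> = 24 * (real l * ?L * h)" by (simp add: algebra_simps)
  also have "\<dots> = 48 * 10^9 * real l ^ 3 * ?L ^ 3 * phiS d X A"
    by (simp add: h_def power2_eq_square power3_eq_cube)
  finally show ?thesis .
qed

end

text \<open>Supplies sets of \<open>k\<close> points, so that the infimum in \<open>OPT\<close> is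
  over a nonempty set.\<close>

lemma infinite_Rd: "d \<ge> 1 \<Longrightarrow> infinite (Rd d)"
proof
  assume d: "d \<ge> 1" and fin: "finite (Rd d)"
  let ?f = "\<lambda>(n::nat) i::nat. if i = 0 then real n else 0"
  have "inj ?f" by (rule injI) (metis of_nat_eq_iff)
  moreover have "range ?f \<subseteq> Rd d" using d by (auto simp: Rd_def)
  ultimately show False using fin finite_subset range_inj_infinite by blast
qed

theorem theorem1p1:
  shows "\<exists>\<alpha>>0. \<forall>(d::nat) (X::(nat \<Rightarrow> real) set) (k::nat) (l::nat).
     d \<ge> 1 \<longrightarrow> finite X \<longrightarrow> X \<noteq> {} \<longrightarrow> X \<subseteq> Rd d \<longrightarrow> k \<ge> 2 \<longrightarrow> l \<ge> 1 \<longrightarrow>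
     measure_pmf.expectation (greedy_kmeanspp d X l (k - 1)) (\<lambda>C. phiS d X C)
       \<le> \<alpha> * real l ^ 3 * ln (real k) ^ 3 * OPT d k X"
proof (intro exI[of _ "48 * 10^9"] conjI allI impI)
  fix d k l :: nat and X :: "(nat \<Rightarrow> real) set"
  assume d: "d \<ge> 1" and X: "finite X" "X \<noteq> {}" "X \<subseteq> Rd d" and k: "k \<ge> 2" and l: "l \<ge> 1"
  let ?E = "measure_pmf.expectation (greedy_kmeanspp d X l (k - 1)) (\<lambda>C. phiS d X C)"
  define c where "c = 48 * 10^9 * real l ^ 3 * ln (real k) ^ 3"
  have c: "c > 0" using k l by (simp add: c_def)
  \<comment> \<open>The estimate holds against every \<open>k\<close>-point set, so after division
    by \<open>c\<close> it passes to the infimum.\<close>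
  have "?E / c \<le> OPT d k X"
    unfolding OPT_def
  proof (rule cInf_greatest)
    obtain C where "C \<subseteq> Rd d" "finite C" "card C = k"
      using infinite_arbitrarily_large[OF infinite_Rd[OF d]] by blast
    then show "{phiS d X C |C. C \<subseteq> Rd d \<and> finite C \<and> card C = k} \<noteq> {}" by blast
  next
    fix y assume "y \<in> {phiS d X C |C. C \<subseteq> Rd d \<and> finite C \<and> card C = k}"
    then obtain A where y: "y = phiS d X A" and A: "finite A" "card A = k" by blast
    have "A \<noteq> {}" using A(2) k by auto
    then have "\<forall>x. \<exists>a. a \<in> A \<and> sqdist d x a = phi d x A" using phi_attained[OF A(1)] by metis
    then obtain asg where asg: "\<And>x. asg x \<in> A \<and> sqdist d x (asg x) = phi d x A" by metis
    interpret clustering d X A k l asg by unfold_locales (use X A k l asg in auto)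
    have "?E \<le> c * y" unfolding c_def y by (rule greedy_cost_le)
    then show "?E / c \<le> y" using c by (simp add: divide_le_eq mult.commute)
  qed
  then have "?E \<le> c * OPT d k X" using c by (simp add: divide_le_eq mult.commute)
  then show "?E \<le> 48 * 10^9 * real l ^ 3 * ln (real k) ^ 3 * OPT d k X" by (simp add: c_def)
qed simp

end
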